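(* Let $E\subset\mathbb{R}_{>1}$ be a finite alphabet, let $\mathbf{B}\in E^{\mathbb{N}}$ be a Cantor real base, and let $b\ge2$ be an integer. Let $A$ be the finite alphabet of digits that can occur in the sequences $d^*_{\sigma^n(\mathbf{B})}(1)$, $n\ge0$, and assume that for every $a\in A$ we are given a first-order formula $\varphi_a(j,n)$ of the structure $\langle\mathbb{N},+,V_b\rangle$ that is true if and only if the digit at position $j$ of $d^*_{\sigma^n(\mathbf{B})}(1)$ equals $a$. Then it is decidable whether a given $b$-automatic sequence over $\mathbb{N}$ is $\mathbf{B}$-admissible.
   Context: A Cantor real base is a sequence $\mathbf{B}=(\beta_n)_{n\in\mathbb{N}}$ of reals $>1$ with $\prod_n\beta_n=+\infty$; $\sigma$ denotes the shift, $\sigma((x_n)_{n})=(x_{n+1})_n$. With $\mathsf{T}_\beta(r)=\beta r-\lfloor\beta r\rfloor$ on $[0,1]$, the greedy $\mathbf{B}$-expansion of $r\in[0,1]$ is $d_{\mathbf{B}}(r)=(a_n)_n$ with $a_n=\lfloor\beta_n\mathsf{T}_{\beta_{n-1}}\cdots\mathsf{T}_{\beta_0}(r)\rfloor$; the quasi-greedy expansion is $d^*_{\mathbf{B}}(r)=\lim_{z\to r^-}d_{\mathbf{B}}(z)$ (limit in the product topology). Positions in sequences are indexed from $0$. An infinite sequence $\mathbf{a}$ over $\mathbb{N}$ is $\mathbf{B}$-admissible if $\mathbf{a}=d_{\mathbf{B}}(x)$ for some $x\in[0,1)$. $V_b\colon\mathbb{N}\to\mathbb{N}$ is given by $V_b(0)=1$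 and, for $n\ge1$, $V_b(n)=b^i$ where $b^i$ is the largest power of $b$ dividing $n$; the structure $\langle\mathbb{N},+,V_b\rangle$ has domain $\mathbb{N}$ and the graphs of $+$ and $V_b$ as relations. *)

theory Defs
  imports "HOL-Analysis.Analysis" "HOL-Library.Nat_Bijection"
begin

section \<open>Cantor real bases\<close>

definition cantor_real_base :: "(nat \<Rightarrow> real) \<Rightarrow> bool" where
  "cantor_real_base B \<longleftrightarrow>
     (\<forall>n. B n > 1) \<and> filterlim (\<lambda>n. \<Prod>i<n. B i) at_top sequentially"

definition shift :: "(nat \<Rightarrow> 'a) \<Rightarrow> nat \<Rightarrow> 'a" where
  "shift x = (\<lambda>n. x (Suc n))"

definition beta_map :: "real \<Rightarrow> real \<Rightarrow> real" where
  "beta_map \<beta> r = \<beta> * r - of_int \<lfloor>\<beta> * r\<rfloor>"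

primrec remainder :: "(nat \<Rightarrow> real) \<Rightarrow> real \<Rightarrow> nat \<Rightarrow> real" where
  "remainder B r 0 = r"
| "remainder B r (Suc n) = beta_map (B n) (remainder B r n)"

definition greedy :: "(nat \<Rightarrow> real) \<Rightarrow> real \<Rightarrow> nat \<Rightarrow> nat" where
  "greedy B r n = nat \<lfloor>B n * remainder B r n\<rfloor>"

text \<open>The topology on \<^typ>\<open>nat \<Rightarrow> nat\<close> is the product of the discrete topologies.\<close>

definition quasi_greedy :: "(nat \<Rightarrow> real) \<Rightarrow> real \<Rightarrow> nat \<Rightarrow> nat" where
  "quasi_greedy B r = (THE l. (greedy B \<longlongrightarrow> l) (at_left r))"

definition admissible :: "(nat \<Rightarrow> real) \<Rightarrow> (nat \<Rightarrow> nat) \<Rightarrow> bool" where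
  "admissible B a \<longleftrightarrow> (\<exists>x. 0 \<le> x \<and> x < 1 \<and> a = greedy B x)"

text \<open>The limit defining the quasi-greedy expansion exists and is unique.\<close>

lemma tendsto_fun_iff:
  fixes f :: "'a \<Rightarrow> 'b \<Rightarrow> 'c::topological_space"
  shows "(f \<longlongrightarrow> l) F \<longleftrightarrow> (\<forall>i. ((\<lambda>z. f z i) \<longlongrightarrow> l i) F)"
  using limitin_componentwise[of "\<lambda>_. euclidean" UNIV f l F]
  by (simp add: euclidean_product_topology)

lemma floor_at_left:
  assumes "filterlim f (at_left L) F"
  shows "\<forall>\<^sub>F z in F. \<lfloor>f z\<rfloor> = \<lceil>L::real\<rceil> - 1"
proof -
  have "\<forall>\<^sub>F y in at_left L. \<lfloor>y\<rfloor> = \<lceil>L\<rceil> - 1"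
  proof (rule eventually_at_leftI[of "of_int (\<lceil>L\<rceil> - 1)"])
    show "of_int (\<lceil>L\<rceil> - 1) < L" by linarith
    fix y assume "y \<in> {real_of_int (\<lceil>L\<rceil> - 1)<..<L}"
    then show "\<lfloor>y\<rfloor> = \<lceil>L\<rceil> - 1"
      by (auto simp: floor_eq_iff) linarith
  qed
  then show ?thesis using assms by (rule eventually_compose_filterlim)
qed

lemma quasi_greedy_tendsto:
  assumes B: "\<And>n. B n > 0"
  shows "(greedy B \<longlongrightarrow> quasi_greedy B r) (at_left r)"
proof -
  have left: "filterlim f (at_left L) F \<longleftrightarrow> (f \<longlongrightarrow> L) F \<and> (\<forall>\<^sub>F z in F. f z < L)"
    for f and L :: real and F :: "real filter"
    by (auto simp: filterlim_at eventually_conj_iff elim!: eventually_mono)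
  have scale: "filterlim (\<lambda>z. B n * f z - c) (at_left (B n * L - c)) F"
    if "filterlim f (at_left L) F" for f and L c and F :: "real filter" and n
    using that B[of n] unfolding left by (auto intro!: tendsto_intros)
  have ex: "\<exists>L. filterlim (\<lambda>z. remainder B z n) (at_left L) (at_left r)" for n
  proof (induction n)
    case 0
    have "filterlim (\<lambda>z. remainder B z 0) (at_left r) (at_left r)"
      by (simp add: filterlim_ident)
    then show ?case ..
  next
    case (Suc n)
    then obtain L where L: "filterlim (\<lambda>z. remainder B z n) (at_left L) (at_left r)" ..
    let ?c = "of_int (\<lceil>B n * L\<rceil> - 1) :: real"
    have "\<forall>\<^sub>F z in at_left r. \<lfloor>B n * remainder B z n\<rfloor> = \<lceil>B n * L\<rceil> - 1"
      using floor_at_left[OF scale[OF L, of n 0]] by simp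
    then have "\<forall>\<^sub>F z in at_left r. B n * remainder B z n - ?c = remainder B z (Suc n)"
      by (rule eventually_mono) (simp add: beta_map_def)
    with scale[OF L, of n ?c]
    have "filterlim (\<lambda>z. remainder B z (Suc n)) (at_left (B n * L - ?c)) (at_left r)"
      by (rule filterlim_mono_eventually[OF _ order_refl order_refl])
    then show ?case ..
  qed
  have "\<exists>d. ((\<lambda>z. greedy B z n) \<longlongrightarrow> d) (at_left r)" for n
  proof -
    obtain L where L: "filterlim (\<lambda>z. remainder B z n) (at_left L) (at_left r)"
      using ex ..
    have "\<forall>\<^sub>F z in at_left r. \<lfloor>B n * remainder B z n\<rfloor> = \<lceil>B n * L\<rceil> - 1"
      using floor_at_left[OF scale[OF L, of n 0]] by simp
    then have "\<forall>\<^sub>F z in at_left r. greedy B z n = nat (\<lceil>B n * L\<rceil> - 1)"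
      by (rule eventually_mono) (simp add: greedy_def)
    then have "((\<lambda>z. greedy B z n) \<longlongrightarrow> nat (\<lceil>B n * L\<rceil> - 1)) (at_left r)"
      by (rule tendsto_eventually)
    then show ?thesis ..
  qed
  then have "\<forall>n. \<exists>d. ((\<lambda>z. greedy B z n) \<longlongrightarrow> d) (at_left r)" ..
  from choice[OF this] obtain d where "\<forall>n. ((\<lambda>z. greedy B z n) \<longlongrightarrow> d n) (at_left r)" ..
  then have d: "(greedy B \<longlongrightarrow> d) (at_left r)"
    by (subst tendsto_fun_iff)
  have "l = d" if l: "(greedy B \<longlongrightarrow> l) (at_left r)" for l
  proof
    fix n
    show "l n = d n"
      using l d unfolding tendsto_fun_iff[of "greedy B"]
      by (intro tendsto_unique[OF trivial_limit_at_left_real]) (erule spec)+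
  qed
  with d show ?thesis
    unfolding quasi_greedy_def by (rule theI)
qed


section \<open>First-order logic over addition and \<open>V\<^sub>b\<close>\<close>

definition V :: "nat \<Rightarrow> nat \<Rightarrow> nat" where
  "V b n = (if n = 0 then 1 else b ^ multiplicity b n)"

datatype fo_formula =
    Eq nat nat
  | Plus nat nat nat
  | VGraph nat nat
  | Neg fo_formula
  | Conj fo_formula fo_formula
  | Ex nat fo_formula

primrec fo_sat :: "nat \<Rightarrow> (nat \<Rightarrow> nat) \<Rightarrow> fo_formula \<Rightarrow> bool" where
  "fo_sat b e (Eq x y) \<longleftrightarrow> e x = e y"
| "fo_sat b e (Plus x y z) \<longleftrightarrow> e x + e y = e z"
| "fo_sat b e (VGraph x y) \<longleftrightarrow> V b (e x) = e y"
| "fo_sat b e (Neg f) \<longleftrightarrow> \<not> fo_sat b e f"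
| "fo_sat b e (Conj f g) \<longleftrightarrow> fo_sat b e f \<and> fo_sat b e g"
| "fo_sat b e (Ex x f) \<longleftrightarrow> (\<exists>k. fo_sat b (e(x := k)) f)"

primrec free_vars :: "fo_formula \<Rightarrow> nat set" where
  "free_vars (Eq x y) = {x, y}"
| "free_vars (Plus x y z) = {x, y, z}"
| "free_vars (VGraph x y) = {x, y}"
| "free_vars (Neg f) = free_vars f"
| "free_vars (Conj f g) = free_vars f \<union> free_vars g"
| "free_vars (Ex x f) = free_vars f - {x}"


section \<open>Automatic sequences\<close>

text \<open>Canonical base-\<open>b\<close> representation, most significant digit first;
  zero is represented by the empty word.\<close>

fun base_rep :: "nat \<Rightarrow> nat \<Rightarrow> nat list" where
  "base_rep b n = (if b < 2 \<or> n = 0 then [] else base_rep b (n div b) @ [n mod b])"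

declare base_rep.simps [simp del]

text \<open>A deterministic finite automaton with output, with states \<open>0, \<dots>, m - 1\<close> where \<open>m\<close> is the
  length of both tables: row \<open>q\<close> of the transition table lists the successors of \<open>q\<close> under the
  letters \<open>0, \<dots>, b - 1\<close>, and entry \<open>q\<close> of the output table is the output of \<open>q\<close>.\<close>

datatype dfao = DFAO (init: nat) (trans: "nat list list") (outp: "nat list")

definition wf_dfao :: "nat \<Rightarrow> dfao \<Rightarrow> bool" where
  "wf_dfao b M \<longleftrightarrow>
     init M < length (outp M) \<and> length (trans M) = length (outp M) \<and>
     (\<forall>row \<in> set (trans M). length row = b \<and> (\<forall>q \<in> set row. q < length (outp M)))"

definition dfao_run :: "dfao \<Rightarrow> nat list \<Rightarrow> nat" where
  "dfao_run M w = foldl (\<lambda>q c. trans M ! q ! c) (init M) w"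

definition dfao_seq :: "nat \<Rightarrow> dfao \<Rightarrow> nat \<Rightarrow> nat" where
  "dfao_seq b M n = outp M ! dfao_run M (base_rep b n)"

definition dfao_encode :: "dfao \<Rightarrow> nat" where
  "dfao_encode M =
     prod_encode (init M,
       prod_encode (list_encode (map list_encode (trans M)), list_encode (outp M)))"


section \<open>Decidability\<close>

text \<open>The total recursive functions (Kleene): \<open>recursive k f\<close> means that \<open>f\<close>, restricted to lists
  of length \<open>k\<close>, is a total recursive function of \<open>k\<close> arguments. Minimisation is only applied
  where it yields a total function. Values on lists of other lengths are irrelevant.\<close>

inductive recursive :: "nat \<Rightarrow> (nat list \<Rightarrow> nat) \<Rightarrow> bool" where
  zero: "recursive k (\<lambda>_. 0)"
| succ: "recursive 1 (\<lambda>xs. Suc (xs ! 0))"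
| proj: "i < k \<Longrightarrow> recursive k (\<lambda>xs. xs ! i)"
| comp: "recursive (length gs) f \<Longrightarrow> \<forall>g \<in> set gs. recursive k g
    \<Longrightarrow> recursive k (\<lambda>xs. f (map (\<lambda>g. g xs) gs))"
| prim_rec: "recursive k f \<Longrightarrow> recursive (Suc (Suc k)) g
    \<Longrightarrow> recursive (Suc k) (\<lambda>xs. rec_nat (f (tl xs)) (\<lambda>y r. g (y # r # tl xs)) (hd xs))"
| mu: "recursive (Suc k) f \<Longrightarrow> \<forall>xs. length xs = k \<longrightarrow> (\<exists>y. f (y # xs) = 0)
    \<Longrightarrow> recursive k (\<lambda>xs. LEAST y. f (y # xs) = 0)"
| ext: "recursive k f \<Longrightarrow> \<forall>xs. length xs = k \<longrightarrow> g xs = f xs \<Longrightarrow> recursive k g"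

definition decidable :: "nat set \<Rightarrow> bool" where
  "decidable D \<longleftrightarrow> recursive 1 (\<lambda>xs. if xs ! 0 \<in> D then 1 else 0)"

end

theory Submission
  imports Defs "HOL-Library.Fun_Lexorder" "HOL-Library.More_List"
begin

text \<open>By a Parry-type criterion, a sequence \<open>a\<close> is admissible iff for every \<open>n\<close> its \<open>n\<close>-th shift is
  lexicographically smaller than the quasi-greedy expansion of 1 in the \<open>n\<close>-th shift of the base.
  Given the formulas \<open>\<phi> a\<close>, this is a first-order condition over addition, \<open>V b\<close> and the fibres of
  the sequence.

  Predicates of this kind have finite kernels: for a predicate \<open>P\<close> on assignments, only finitely
  many predicates arise by repeatedly passing from \<open>P e\<close> to \<open>P (b e + r)\<close> with digits \<open>r < b\<close>. A
  bound on the size of the kernel is computable from the automaton, and by pumping it bounds a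
  witness of any satisfied existential quantifier. So every quantifier can be replaced by a
  computably bounded one, and no automata have to be constructed by the decision procedure.\<close>

section \<open>Closure properties of the recursive functions\<close>

named_theorems recursive_intros

lemma recursive_subst:
  assumes "recursive m f" "\<And>i. i < m \<Longrightarrow> recursive k (\<lambda>xs. s xs ! i)"
    and "\<And>xs. length xs = k \<Longrightarrow> length (s xs) = m"
  shows "recursive k (\<lambda>xs. f (s xs))"
proof -
  let ?gs = "map (\<lambda>i xs. s xs ! i) [0..<m]"
  have "recursive k (\<lambda>xs. f (map (\<lambda>g. g xs) ?gs))"
    using assms by (intro recursive.comp) auto
  moreover have "map (\<lambda>g. g xs) ?gs = s xs" if "length xs = k" for xs
    using map_nth[of "s xs"] assms(3)[OF that] by (simp add: comp_def)
  ultimately show ?thesis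
    by (auto elim: recursive.ext)
qed

lemma recursive_hd [recursive_intros]: "recursive (Suc k) hd"
  by (rule recursive.ext[OF recursive.proj[of 0]]) (auto intro: hd_conv_nth)

lemma recursive_tl [recursive_intros]:
  assumes "recursive k f"
  shows "recursive (Suc k) (\<lambda>xs. f (tl xs))"
  by (rule recursive_subst[OF assms])
    (auto simp: nth_tl intro: recursive.ext[OF recursive.proj])

lemma recursive_subst_Cons:
  assumes "recursive (Suc m) f" "recursive k n" "\<And>i. i < m \<Longrightarrow> recursive k (\<lambda>xs. s xs ! i)"
    and "\<And>xs. length xs = k \<Longrightarrow> length (s xs) = m"
  shows "recursive k (\<lambda>xs. f (n xs # s xs))"
  using assms(2-) by (intro recursive_subst[OF assms(1)]) (auto simp: less_Suc_eq_0_disj)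

lemma recursive_unary:
  assumes "recursive 1 (\<lambda>xs. f (hd xs))" "recursive k g"
  shows "recursive k (\<lambda>xs. f (g xs))"
  using recursive_subst_Cons[of 0 "\<lambda>xs. f (hd xs)" k g "\<lambda>_. []"] assms by simp

lemma recursive_Suc [recursive_intros]:
  assumes "recursive k f"
  shows "recursive k (\<lambda>xs. Suc (f xs))"
proof (rule recursive_unary[OF _ assms])
  show "recursive 1 (\<lambda>xs. Suc (hd xs))"
    by (rule recursive.ext[OF recursive.succ]) (auto simp: length_Suc_conv)
qed

lemma recursive_const [recursive_intros]: "recursive k (\<lambda>_. n)"
  by (induction n) (intro recursive.zero recursive_Suc)+

lemma recursive_rec_nat:
  assumes "recursive k f" "recursive (Suc (Suc k)) (\<lambda>ys. g (hd ys) (hd (tl ys)) (tl (tl ys)))"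
    and "recursive k n"
  shows "recursive k (\<lambda>xs. rec_nat (f xs) (\<lambda>y r. g y r xs) (n xs))"
  using recursive_subst_Cons[OF recursive.prim_rec[OF assms(1,2)] assms(3), of "\<lambda>xs. xs"]
  by (simp add: recursive.proj)

lemma recursive_add [recursive_intros]:
  assumes "recursive k f" "recursive k g"
  shows "recursive k (\<lambda>xs. f xs + g xs)"
proof -
  have "rec_nat m (\<lambda>_ r. Suc r) n = m + n" for m n :: nat
    by (induction n) auto
  moreover have "recursive k (\<lambda>xs. rec_nat (f xs) (\<lambda>_ r. Suc r) (g xs))"
    by (intro recursive_rec_nat recursive_intros assms)
  ultimately show ?thesis by simp
qed

lemma recursive_mult [recursive_intros]:
  assumes "recursive k f" "recursive k g"
  shows "recursive k (\<lambda>xs. f xs * g xs)"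
proof -
  have "rec_nat 0 (\<lambda>_ r. r + m) n = m * n" for m n :: nat
    by (induction n) auto
  moreover have "recursive k (\<lambda>xs. rec_nat 0 (\<lambda>_ r. r + f xs) (g xs))"
    by (intro recursive_rec_nat recursive_intros assms)
  ultimately show ?thesis by simp
qed

lemma recursive_power [recursive_intros]:
  assumes "recursive k f" "recursive k g"
  shows "recursive k (\<lambda>xs. f xs ^ g xs)"
proof -
  have "rec_nat 1 (\<lambda>_ r. r * m) n = m ^ n" for m n :: nat
    by (induction n) auto
  moreover have "recursive k (\<lambda>xs. rec_nat 1 (\<lambda>_ r. r * f xs) (g xs))"
    by (intro recursive_rec_nat recursive_intros assms)
  ultimately show ?thesis by simp
qed

lemma recursive_diff [recursive_intros]:
  assumes "recursive k f" "recursive k g"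
  shows "recursive k (\<lambda>xs. f xs - g xs)"
proof -
  have predecessor: "recursive k' (\<lambda>xs. h xs - 1)" if "recursive k' h" for k' h
  proof -
    have "rec_nat 0 (\<lambda>y _. y) n = n - 1" for n :: nat
      by (cases n) auto
    moreover have "recursive k' (\<lambda>xs. rec_nat 0 (\<lambda>y _. y) (h xs))"
      by (intro recursive_rec_nat recursive_intros that)
    ultimately show ?thesis by simp
  qed
  have "rec_nat m (\<lambda>_ r. r - 1) n = m - n" for m n :: nat
    by (induction n) auto
  moreover have "recursive k (\<lambda>xs. rec_nat (f xs) (\<lambda>_ r. r - 1) (g xs))"
    by (intro recursive_rec_nat predecessor recursive_intros assms)
  ultimately show ?thesis by simp
qed

lemma recursive_nth_default [recursive_intros]: "recursive k (\<lambda>xs. nth_default 0 xs i)"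
proof (cases "i < k")
  case True
  show ?thesis
    by (rule recursive.ext[OF recursive.proj[OF True]]) (simp add: True nth_default_nth)
next
  case False
  then show ?thesis
    by (intro recursive.ext[OF recursive.zero]) (simp add: nth_default_beyond)
qed

lemma recursive_sum_list: "recursive k sum_list"
proof (induction k)
  case 0
  show ?case by (rule recursive.ext[OF recursive.zero]) simp
next
  case (Suc k)
  have "recursive (Suc k) (\<lambda>xs. hd xs + sum_list (tl xs))"
    by (intro recursive_intros Suc)
  then show ?case
    by (rule recursive.ext) (auto simp: length_Suc_conv)
qed

definition recursive_pred :: "nat \<Rightarrow> (nat list \<Rightarrow> bool) \<Rightarrow> bool" where
  "recursive_pred k P \<longleftrightarrow> recursive k (\<lambda>xs. of_bool (P xs))"

lemma recursive_pred_cong: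
  assumes "recursive_pred k P" "\<And>xs. length xs = k \<Longrightarrow> Q xs = P xs"
  shows "recursive_pred k Q"
  using assms unfolding recursive_pred_def by (auto elim!: recursive.ext)

lemma recursive_pred_False: "recursive_pred k (\<lambda>_. False)"
  unfolding recursive_pred_def by (rule recursive_const)

lemma recursive_pred_not [recursive_intros]:
  assumes "recursive_pred k P"
  shows "recursive_pred k (\<lambda>xs. \<not> P xs)"
proof -
  have "of_bool (\<not> Q) = (1::nat) - of_bool Q" for Q
    by simp
  moreover have "recursive k (\<lambda>xs. 1 - of_bool (P xs))"
    using assms unfolding recursive_pred_def by (intro recursive_intros)
  ultimately show ?thesis by (simp only: recursive_pred_def)
qed

lemma recursive_pred_conj [recursive_intros]:
  assumes "recursive_pred k P" "recursive_pred k Q"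
  shows "recursive_pred k (\<lambda>xs. P xs \<and> Q xs)"
  using recursive_mult assms by (simp add: recursive_pred_def of_bool_conj)

lemma recursive_pred_disj [recursive_intros]:
  assumes "recursive_pred k P" "recursive_pred k Q"
  shows "recursive_pred k (\<lambda>xs. P xs \<or> Q xs)"
  using recursive_pred_not[OF recursive_pred_conj[OF assms[THEN recursive_pred_not]]] by simp

lemma recursive_pred_le [recursive_intros]:
  assumes "recursive k f" "recursive k g"
  shows "recursive_pred k (\<lambda>xs. f xs \<le> g xs)"
proof -
  have "of_bool (m \<le> n) = 1 - (m - n)" for m n :: nat
    by auto
  moreover have "recursive k (\<lambda>xs. 1 - (f xs - g xs))"
    by (intro recursive_intros assms)
  ultimately show ?thesis by (simp only: recursive_pred_def)
qed

lemma recursive_pred_less [recursive_intros]: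
  assumes "recursive k f" "recursive k g"
  shows "recursive_pred k (\<lambda>xs. f xs < g xs)"
  using recursive_pred_le[OF recursive_Suc[OF assms(1)] assms(2)] by (simp add: Suc_le_eq)

lemma recursive_pred_eq [recursive_intros]:
  assumes "recursive k f" "recursive k g"
  shows "recursive_pred k (\<lambda>xs. f xs = g xs)"
  using recursive_pred_conj[OF recursive_pred_le[OF assms] recursive_pred_le[OF assms(2,1)]]
  by (simp add: order_eq_iff)

lemma recursive_if [recursive_intros]:
  assumes "recursive_pred k P" "recursive k f" "recursive k g"
  shows "recursive k (\<lambda>xs. if P xs then f xs else g xs)"
proof -
  have "(if Q then m else n) = of_bool Q * m + of_bool (\<not> Q) * n" for Q and m n :: nat
    by simp
  then show ?thesis
    using assms recursive_pred_not[OF assms(1)]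
    by (simp add: recursive_pred_def recursive_add recursive_mult)
qed

lemma recursive_pred_bex [recursive_intros]:
  assumes "recursive_pred (Suc k) (\<lambda>ys. P (hd ys) (tl ys))" "recursive k n"
  shows "recursive_pred k (\<lambda>xs. \<exists>y<n xs. P y xs)"
proof -
  define count where "count xs = rec_nat (0::nat) (\<lambda>y r. r + of_bool (P y xs))" for xs
  have "recursive (Suc (Suc k)) (\<lambda>ys. tl (tl ys) ! i)" if "i < k" for i
    using that by (intro recursive_tl recursive.proj)
  then have "recursive (Suc (Suc k)) (\<lambda>ys. of_bool (P (hd ys) (tl (tl ys))))"
    using recursive_subst_Cons[OF assms(1)[unfolded recursive_pred_def] recursive_hd,
        of "Suc k" "\<lambda>ys. tl (tl ys)"] by simp
  then have "recursive k (\<lambda>xs. count xs (n xs))"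
    unfolding count_def by (intro recursive_rec_nat recursive_intros assms(2))
  then have "recursive_pred k (\<lambda>xs. 0 < count xs (n xs))"
    by (intro recursive_intros)
  moreover have "0 < count xs m \<longleftrightarrow> (\<exists>y<m. P y xs)" for m xs
    by (induction m) (auto simp: count_def less_Suc_eq)
  ultimately show ?thesis by simp
qed

lemma recursive_pred_ball [recursive_intros]:
  assumes "recursive_pred (Suc k) (\<lambda>ys. P (hd ys) (tl ys))" "recursive k n"
  shows "recursive_pred k (\<lambda>xs. \<forall>y<n xs. P y xs)"
  using recursive_pred_not[OF recursive_pred_bex[OF recursive_pred_not[OF assms(1)] assms(2)]]
  by simp

lemma recursive_Least:
  assumes "recursive_pred (Suc k) (\<lambda>ys. P (hd ys) (tl ys))"
    and "\<And>xs. length xs = k \<Longrightarrow> \<exists>y. P y xs"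
  shows "recursive k (\<lambda>xs. LEAST y. P y xs)"
  using recursive.mu[OF recursive_pred_not[OF assms(1), unfolded recursive_pred_def]] assms(2)
  by simp

lemma recursive_if_recursive_graph:
  assumes "recursive_pred (Suc k) (\<lambda>ys. hd ys = f (tl ys))"
  shows "recursive k f"
proof -
  have "(LEAST y. y = f xs) = f xs" for xs
    by (rule Least_equality) auto
  then show ?thesis
    using recursive_Least[where P = "\<lambda>y xs. y = f xs", OF assms] by simp
qed

lemma eq_div_iff:
  "q = m div n \<longleftrightarrow> n = 0 \<and> q = 0 \<or> q * n \<le> m \<and> m < Suc q * n" for m n q :: nat
  by (cases "n = 0")
    (auto simp: div_times_less_eq_dividend dividend_less_times_div mult.commute
      intro!: div_nat_eqI[symmetric])

lemma recursive_div [recursive_intros]: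
  assumes "recursive k f" "recursive k g"
  shows "recursive k (\<lambda>xs. f xs div g xs)"
  by (rule recursive_if_recursive_graph, unfold eq_div_iff) (intro recursive_intros assms)

lemma recursive_mod [recursive_intros]:
  assumes "recursive k f" "recursive k g"
  shows "recursive k (\<lambda>xs. f xs mod g xs)"
  unfolding minus_mult_div_eq_mod[symmetric] by (intro recursive_intros assms)

lemma recursive_prod_encode [recursive_intros]:
  assumes "recursive k f" "recursive k g"
  shows "recursive k (\<lambda>xs. prod_encode (f xs, g xs))"
  unfolding prod_encode_def triangle_def split_conv by (intro recursive_intros assms)

lemma eq_fst_prod_decode_iff: "i = fst (prod_decode n) \<longleftrightarrow> (\<exists>j<Suc n. prod_encode (i, j) = n)"
  by (auto simp: less_Suc_eq_le intro!: le_prod_encode_2 exI[of _ "snd (prod_decode n)"])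
    (metis le_prod_encode_2 prod.collapse prod_decode_inverse)

lemma eq_snd_prod_decode_iff: "j = snd (prod_decode n) \<longleftrightarrow> (\<exists>i<Suc n. prod_encode (i, j) = n)"
  by (auto simp: less_Suc_eq_le intro!: le_prod_encode_1 exI[of _ "fst (prod_decode n)"])
    (metis le_prod_encode_1 prod.collapse prod_decode_inverse)

lemma recursive_fst_prod_decode [recursive_intros]:
  assumes "recursive k f"
  shows "recursive k (\<lambda>xs. fst (prod_decode (f xs)))"
  by (rule recursive_if_recursive_graph, unfold eq_fst_prod_decode_iff)
    (intro recursive_intros assms)

lemma recursive_snd_prod_decode [recursive_intros]:
  assumes "recursive k f"
  shows "recursive k (\<lambda>xs. snd (prod_decode (f xs)))"
  by (rule recursive_if_recursive_graph, unfold eq_snd_prod_decode_iff)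
    (intro recursive_intros assms)

lemma prod_decode_0: "prod_decode 0 = (0, 0)"
  by (simp add: prod_decode_def prod_decode_aux.simps)

lemma nth_default_0_list_decode: "nth_default 0 (list_decode c) 0 = fst (prod_decode (c - 1))"
  by (cases c) (auto simp: prod_decode_0 split: prod.splits)

lemma list_encode_tl_list_decode:
  "list_encode (tl (list_decode c)) = snd (prod_decode (c - 1))"
  by (cases c) (auto simp: prod_decode_0 split: prod.splits)

lemma recursive_list_encode_drop:
  assumes "recursive k f" "recursive k g"
  shows "recursive k (\<lambda>xs. list_encode (drop (g xs) (list_decode (f xs))))"
proof -
  have "rec_nat c (\<lambda>_ r. snd (prod_decode (r - 1))) i = list_encode (drop i (list_decode c))"
    for c i
    by (induction i)
      (simp_all add: list_encode_tl_list_decode[symmetric] drop_Suc tl_drop del: One_nat_def)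
  moreover have "recursive k (\<lambda>xs. rec_nat (f xs) (\<lambda>_ r. snd (prod_decode (r - 1))) (g xs))"
    by (intro recursive_rec_nat recursive_intros assms)
  ultimately show ?thesis by simp
qed

lemma recursive_nth_default_list_decode [recursive_intros]:
  assumes "recursive k f" "recursive k g"
  shows "recursive k (\<lambda>xs. nth_default 0 (list_decode (f xs)) (g xs))"
proof -
  have "nth_default 0 ys i = nth_default 0 (drop i ys) 0" for ys :: "nat list" and i
    by (simp add: nth_default_def)
  then have "nth_default 0 (list_decode c) i =
      fst (prod_decode (list_encode (drop i (list_decode c)) - 1))" for c i
    by (metis list_encode_inverse nth_default_0_list_decode)
  then show ?thesis
    by (simp only:) (intro recursive_intros recursive_list_encode_drop assms)
qed

lemma recursive_length_list_decode [recursive_intros]: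
  assumes "recursive k f"
  shows "recursive k (\<lambda>xs. length (list_decode (f xs)))"
proof -
  have "list_encode ys = 0 \<longleftrightarrow> ys = []" for ys
    by (cases ys) auto
  then have "(LEAST i. list_encode (drop i ys) = 0) = length ys" for ys
    by (auto intro: Least_equality)
  moreover have "recursive k (\<lambda>xs. LEAST i. list_encode (drop i (list_decode (f xs))) = 0)"
  proof (rule recursive_Least)
    show "recursive_pred (Suc k)
        (\<lambda>ys. list_encode (drop (hd ys) (list_decode (f (tl ys)))) = 0)"
      by (intro recursive_intros recursive_list_encode_drop assms)
    show "\<exists>i. list_encode (drop i (list_decode (f xs))) = 0" for xs
      by (rule exI[of _ "length (list_decode (f xs))"]) simp
  qed
  ultimately show ?thesis by simp
qed

section \<open>Kernels of predicates on assignments\<close>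

definition residual :: "nat \<Rightarrow> ('v \<Rightarrow> nat) \<Rightarrow> (('v \<Rightarrow> nat) \<Rightarrow> bool) \<Rightarrow> ('v \<Rightarrow> nat) \<Rightarrow> bool" where
  "residual b r P = (\<lambda>e. P (\<lambda>i. b * e i + r i))"

lemma residual_residual: "residual b r (residual m s P) = residual (b * m) (\<lambda>i. m * r i + s i) P"
  by (simp add: residual_def algebra_simps)

lemma residual_fun_upd:
  "residual b (r(x := s)) P (e(x := k)) \<longleftrightarrow> P ((\<lambda>i. b * e i + r i)(x := b * k + s))"
proof -
  have "(\<lambda>i. b * (e(x := k)) i + (r(x := s)) i) = (\<lambda>i. b * e i + r i)(x := b * k + s)"
    by auto
  then show ?thesis by (simp only: residual_def)
qed

inductive_set kernel :: "nat \<Rightarrow> (('v \<Rightarrow> nat) \<Rightarrow> bool) \<Rightarrow> (('v \<Rightarrow> nat) \<Rightarrow> bool) set"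
  for b P where
  self: "P \<in> kernel b P"
| residual: "Q \<in> kernel b P \<Longrightarrow> (\<And>i. r i < b) \<Longrightarrow> residual b r Q \<in> kernel b P"

lemma residual_power_in_kernel:
  assumes "\<And>i. r i < b ^ n"
  shows "residual (b ^ n) r P \<in> kernel b P"
  using assms
proof (induction n arbitrary: r)
  case 0
  then have "residual (b ^ 0) r P = P" by (simp add: residual_def)
  then show ?case by (simp add: kernel.self)
next
  case (Suc n)
  have "0 < b ^ n" using Suc.prems[of undefined] by (cases b) auto
  then  have "residual b (\<lambda>i. r i div b ^ n) (residual (b ^ n) (\<lambda>i. r i mod b ^ n) P) \<in> kernel b P"
    using Suc.prems by (intro kernel.residual Suc.IH) (auto simp: less_mult_imp_div_less)
  then show ?case by (simp add: residual_residual)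
qed

definition kernel_bounded :: "nat \<Rightarrow> nat \<Rightarrow> (('v \<Rightarrow> nat) \<Rightarrow> bool) \<Rightarrow> bool" where
  "kernel_bounded b N P \<longleftrightarrow> finite (kernel b P) \<and> card (kernel b P) \<le> N"

lemma kernel_boundedI:
  assumes "P \<in> K" "\<And>Q r. Q \<in> K \<Longrightarrow> (\<And>i. r i < b) \<Longrightarrow> residual b r Q \<in> K"
    and "finite K" "card K \<le> N"
  shows "kernel_bounded b N P"
proof -
  have "Q \<in> K" if "Q \<in> kernel b P" for Q
    using that by induction (auto intro: assms(1,2))
  then have "kernel b P \<subseteq> K" by blast
  then show ?thesis
    unfolding kernel_bounded_def using assms(3,4) card_mono finite_subset order_trans by metis
qed

lemma kernel_bounded_image:
  assumes "finite S" "card S \<le> N" "P \<in> h ` S"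
    and "\<And>s r. s \<in> S \<Longrightarrow> (\<And>i. r i < b) \<Longrightarrow> residual b r (h s) \<in> h ` S"
  shows "kernel_bounded b N P"
  using assms card_image_le[OF assms(1), of h] by (intro kernel_boundedI[of _ "h ` S"]) auto

lemma kernel_bounded_not:
  assumes "kernel_bounded b N P"
  shows "kernel_bounded b N (\<lambda>e. \<not> P e)"
proof (rule kernel_bounded_image)
  let ?not = "\<lambda>Q e. \<not> Q e"
  show "finite (kernel b P)" "card (kernel b P) \<le> N"
    using assms by (auto simp: kernel_bounded_def)
  show "?not P \<in> ?not ` kernel b P"
    by (intro imageI kernel.self)
  show "residual b r (?not Q) \<in> ?not ` kernel b P" if "Q \<in> kernel b P" "\<And>i. r i < b" for Q r
    by (rule rev_image_eqI[OF kernel.residual[OF that]]) (simp add: residual_def)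
qed

lemma kernel_bounded_conj:
  assumes "kernel_bounded b N P" "kernel_bounded b M Q"
  shows "kernel_bounded b (N * M) (\<lambda>e. P e \<and> Q e)"
proof (rule kernel_bounded_image)
  let ?conj = "\<lambda>(P, Q) e. P e \<and> Q e" and ?S = "kernel b P \<times> kernel b Q"
  show "finite ?S" "card ?S \<le> N * M"
    using assms by (auto simp: kernel_bounded_def card_cartesian_product intro: mult_le_mono)
  show "(\<lambda>e. P e \<and> Q e) \<in> ?conj ` ?S"
    by (rule rev_image_eqI[of "(P, Q)"]) (auto intro: kernel.self)
  show "residual b r (?conj s) \<in> ?conj ` ?S" if "s \<in> ?S" "\<And>i. r i < b" for s r
  proof -
    obtain P' Q' where s_eq: "s = (P', Q')" and "P' \<in> kernel b P" "Q' \<in> kernel b Q"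
      using \<open>s \<in> ?S\<close> by blast
    then have "(residual b r P', residual b r Q') \<in> ?S"
      using that(2) by (auto intro: kernel.residual)
    then show ?thesis by (rule rev_image_eqI) (simp add: s_eq residual_def)
  qed
qed

lemma kernel_bounded_False: "kernel_bounded b 1 (\<lambda>_. False)"
  by (rule kernel_boundedI[of _ "{\<lambda>_. False}"]) (auto simp: residual_def)

lemma residual_Ex:
  assumes "b > 0"
  shows "residual b r (\<lambda>e. \<exists>k. P (e(x := k))) e \<longleftrightarrow>
    (\<exists>s<b. \<exists>k. residual b (r(x := s)) P (e(x := k)))"
proof
  assume "residual b r (\<lambda>e. \<exists>k. P (e(x := k))) e"
  then obtain k where "P ((\<lambda>i. b * e i + r i)(x := b * (k div b) + k mod b))"
    by (auto simp: residual_def)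
  then show "\<exists>s<b. \<exists>k. residual b (r(x := s)) P (e(x := k))"
    unfolding residual_fun_upd[symmetric] using mod_less_divisor[OF assms] by blast
next
  assume "\<exists>s<b. \<exists>k. residual b (r(x := s)) P (e(x := k))"
  then show "residual b r (\<lambda>e. \<exists>k. P (e(x := k))) e"
    unfolding residual_fun_upd by (auto simp: residual_def)
qed

text \<open>The subset construction for nondeterministic automata. Digits are read starting with the least
  significant one, so leading zeros play no role.\<close>

lemma kernel_bounded_Ex:
  assumes "kernel_bounded b N P" "b > 0"
  shows "kernel_bounded b (2 ^ N) (\<lambda>e. \<exists>k. P (e(x := k)))"
proof (rule kernel_bounded_image)
  let ?ex = "\<lambda>T e. \<exists>k. \<exists>Q\<in>T. Q (e(x := k))" and ?S = "Pow (kernel b P)"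
  show "finite ?S" "card ?S \<le> 2 ^ N"
    using assms(1) by (auto simp: kernel_bounded_def card_Pow)
  show "(\<lambda>e. \<exists>k. P (e(x := k))) \<in> ?ex ` ?S"
    by (rule rev_image_eqI[of "{P}"]) (auto intro: kernel.self)
  show "residual b r (?ex T) \<in> ?ex ` ?S" if "T \<in> ?S" "\<And>i. r i < b" for T r
  proof (rule rev_image_eqI)
    let ?T = "(\<lambda>(s, Q). residual b (r(x := s)) Q) ` ({..<b} \<times> T)"
    show "?T \<in> ?S" using that by (auto intro!: kernel.residual)
    have residual_union: "residual b s (\<lambda>e. \<exists>Q\<in>T. Q e) = (\<lambda>e. \<exists>Q\<in>T. residual b s Q e)" for s
      by (simp add: residual_def)
    show "residual b r (?ex T) = ?ex ?T"
      using residual_Ex[OF \<open>b > 0\<close>, of r "\<lambda>e. \<exists>Q\<in>T. Q e" x]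
      unfolding fun_eq_iff residual_union by (simp add: Bex_def) blast
  qed
qed

lemma div_power_less_div_power:
  fixes b k :: nat
  assumes "b \<ge> 2" "i < j" "b ^ i \<le> k"
  shows "k div b ^ j < k div b ^ i"
proof -
  have "k div b ^ j = k div b ^ i div b ^ (j - i)"
    using assms(2) by (simp add: div_mult2_eq[symmetric] power_add[symmetric])
  also have "\<dots> < k div b ^ i"
    using assms one_less_power[of b "j - i"]
    by (intro div_less_dividend) (auto simp: div_greater_zero_iff)
  finally show ?thesis .
qed

lemma residual_fun_upd_mod_in_kernel:
  assumes "b \<ge> 2" "\<And>i. e i < b ^ L" "L \<le> j"
  shows "residual (b ^ j) (e(x := k mod b ^ j)) P \<in> kernel b P"
proof (rule residual_power_in_kernel)
  have "b ^ L \<le> b ^ j" using assms(1,3) by (intro power_increasing) auto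
  then have "e i < b ^ j" for i using assms(2)[of i] by simp
  then show "(e(x := k mod b ^ j)) i < b ^ j" for i
    using assms(1) by simp
qed

lemma remove_digits_if_residuals_eq:
  assumes "residual (b ^ i) (e(x := k mod b ^ i)) P = residual (b ^ j) (e(x := k mod b ^ j)) P"
    and "P (e(x := k))"
  shows "P (e(x := b ^ i * (k div b ^ j) + k mod b ^ i))"
proof -
  have residual_zero: "residual (b ^ l) (e(x := k mod b ^ l)) P ((\<lambda>_. 0)(x := m)) \<longleftrightarrow>
      P (e(x := b ^ l * m + k mod b ^ l))" for l m
    by (simp add: residual_fun_upd)
  show ?thesis
    using residual_zero[of i "k div b ^ j"] residual_zero[of j "k div b ^ j"] assms by simp
qed

text \<open>Pumping: if the least witness \<open>k\<close> were at least \<open>b ^ (L + N)\<close>, two of the residuals along its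
  digits at positions \<open>L, \<dots>, L + N\<close> would agree, and removing the digits in between would yield a
  smaller witness.\<close>

lemma bounded_witness_if_kernel_bounded:
  assumes base: "b \<ge> 2" and bounded: "kernel_bounded b N P"
    and e_less: "\<And>i. e i < b ^ L" and "P (e(x := k))"
  shows "\<exists>k < b ^ (L + N). P (e(x := k))"
proof -
  define k where "k = (LEAST k. P (e(x := k)))"
  have witness: "P (e(x := k))" and least: "\<And>j. P (e(x := j)) \<Longrightarrow> k \<le> j"
    using assms(4) unfolding k_def by (auto intro: LeastI Least_le)
  define R where "R j = residual (b ^ j) (e(x := k mod b ^ j)) P" for j
  have "k < b ^ (L + N)"
  proof (rule ccontr)
    assume "\<not> k < b ^ (L + N)"
    have "R i \<noteq> R j" if "i < j" "j \<le> L + N" for i j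
    proof
      assume "R i = R j"
      then have "k \<le> b ^ i * (k div b ^ j) + k mod b ^ i"
        using remove_digits_if_residuals_eq[of b i e x k P j] witness
        by (intro least) (simp add: R_def)
      then have "b ^ i * (k div b ^ i) \<le> b ^ i * (k div b ^ j)"
        using mult_div_mod_eq[of "b ^ i" k] by linarith
      then have "k div b ^ i \<le> k div b ^ j" using base by simp
      moreover have "b ^ i \<le> b ^ (L + N)" using base that by (intro power_increasing) auto
      then have "b ^ i \<le> k" using \<open>\<not> k < b ^ (L + N)\<close> by linarith
      then have "k div b ^ j < k div b ^ i"
        using base \<open>i < j\<close> by (intro div_power_less_div_power)
      ultimately show False by simp
    qed
    then have "inj_on R {L..L + N}"
      by (intro linorder_inj_onI) auto
    moreover have "R ` {L..L + N} \<subseteq> kernel b P"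
      using residual_fun_upd_mod_in_kernel[OF base e_less] by (auto simp: R_def)
    ultimately have "card {L..L + N} \<le> card (kernel b P)"
      using bounded by (intro card_inj_on_le) (auto simp: kernel_bounded_def)
    also have "\<dots> \<le> N" using bounded by (simp add: kernel_bounded_def)
    finally show False by simp
  qed
  with witness show ?thesis by blast
qed

lemma base_mult_add_eq_iff:
  fixes b :: nat
  assumes "r < b" "s < b"
  shows "b * m + r = b * n + s \<longleftrightarrow> m = n \<and> r = s"
proof -
  have "(b * m + r) div b = m" "(b * m + r) mod b = r"
    "(b * n + s) div b = n" "(b * n + s) mod b = s"
    using assms by auto
  then show ?thesis by metis
qed

lemma kernel_bounded_eq: "kernel_bounded b 2 (\<lambda>e. e x = e y)"
proof (rule kernel_boundedI)
  let ?K = "{\<lambda>e. e x = e y, \<lambda>_. False}"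
  show "card ?K \<le> 2" by (intro card_insert_le_m1) auto
  show "residual b r Q \<in> ?K" if "Q \<in> ?K" and digits: "\<And>i. r i < b" for Q r
    using that(1) digits[of x]
    by (cases "r x = r y") (auto simp: residual_def base_mult_add_eq_iff[OF digits digits])
qed auto

lemma kernel_bounded_eq_const: "kernel_bounded b (n + 2) (\<lambda>e. e x = n)"
proof (rule kernel_boundedI)
  let ?eq = "\<lambda>m e. e x = m"
  let ?K = "insert (\<lambda>_. False) (?eq ` {..n})"
  have "card (?eq ` {..n}) \<le> n + 1" using card_image_le[of "{..n}" ?eq] by simp
  then show "card ?K \<le> n + 2" by (intro card_insert_le_m1) auto
  show "residual b r Q \<in> ?K" if "Q \<in> ?K" and digits: "\<And>i. r i < b" for Q r
  proof -
    have "residual b r (?eq m) = (if m mod b = r x then ?eq (m div b) else (\<lambda>_. False))" for m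
      using base_mult_add_eq_iff[OF digits[of x], of "m mod b" _ "m div b"] digits[of x]
      by (auto simp: residual_def fun_eq_iff)
    moreover have "residual b r (\<lambda>_. False) = (\<lambda>_. False)"
      by (simp add: residual_def)
    moreover have "m div b \<le> n" if "m \<le> n" for m
      using div_le_dividend that by (rule order_trans)
    ultimately show ?thesis using \<open>Q \<in> ?K\<close> by auto
  qed
qed auto

text \<open>The residuals of addition are given by the carry bit \<open>c\<close>.\<close>

lemma kernel_bounded_add: "kernel_bounded b 3 (\<lambda>e. e x + e y = e z)"
proof (rule kernel_boundedI)
  let ?add = "\<lambda>c e. e x + e y + c = (e z :: nat)"
  let ?K = "{?add 0, ?add 1, \<lambda>_. False}"
  show "card ?K \<le> 3" by (intro card_insert_le_m1) auto
  fix Q and r :: "'a \<Rightarrow> nat"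
  assume "Q \<in> ?K" and digits: "\<And>i. r i < b"
  have residual_add: "residual b r (?add c) \<in> ?K" if "c \<le> 1" for c
  proof -
    define carry digit where "carry = (r x + r y + c) div b" and "digit = (r x + r y + c) mod b"
    have "r x + r y + c < 2 * b" using digits[of x] digits[of y] that by linarith
    then have "carry < 2" unfolding carry_def by (simp add: less_mult_imp_div_less)
    then have carry_bit: "carry = 0 \<or> carry = 1" by linarith
    have digit_less: "digit < b" using digits[of x] by (simp add: digit_def)
    have "r x + r y + c = b * carry + digit" by (simp add: carry_def digit_def)
    then have "b * e x + r x + (b * e y + r y) + c = b * (e x + e y + carry) + digit" for e
      by (simp add: algebra_simps)
    then have "residual b r (?add c) e \<longleftrightarrow> b * (e x + e y + carry) + digit = b * e z + r z" for e
      by (simp only: residual_def)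
    then have "residual b r (?add c) = (\<lambda>e. ?add carry e \<and> digit = r z)"
      by (simp only: base_mult_add_eq_iff[OF digit_less digits] fun_eq_iff) blast
    with carry_bit show ?thesis by (cases "digit = r z") auto
  qed
  have "residual b r (\<lambda>_. False) = (\<lambda>_. False)" by (simp add: residual_def)
  then show "residual b r Q \<in> ?K"
    using \<open>Q \<in> ?K\<close> residual_add[of 0] residual_add[of 1] by auto
qed auto

lemma V_0: "V b 0 = 1"
  by (simp add: V_def)

lemma V_mult_base:
  assumes "b \<ge> 2" "n > 0"
  shows "V b (b * n) = b * V b n"
  using assms by (simp add: V_def multiplicity_times_same)

lemma V_not_dvd:
  assumes "\<not> b dvd n"
  shows "V b n = 1"
  using assms by (simp add: V_def not_dvd_imp_multiplicity_0)

lemma kernel_bounded_V_pos: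
  assumes base: "b \<ge> 2"
  shows "kernel_bounded b 3 (\<lambda>e. e x > 0 \<and> V b (e x) = e y)"
proof (rule kernel_boundedI)
  let ?V = "\<lambda>e. e x > 0 \<and> V b (e x) = e y" and ?zero = "\<lambda>e. e y = (0::nat)"
  let ?K = "{?V, ?zero, \<lambda>_. False}"
  show "card ?K \<le> 3" by (intro card_insert_le_m1) auto
  fix Q and r :: "'a \<Rightarrow> nat"
  assume "Q \<in> ?K" and digits: "\<And>i. r i < b"
  have "residual b r ?V \<in> ?K"
  proof (cases "r x = 0")
    case True
    have "residual b r ?V e \<longleftrightarrow> e x > 0 \<and> b * V b (e x) + 0 = b * e y + r y" for e
      using True base by (auto simp: residual_def V_mult_base)
    then have "residual b r ?V = (\<lambda>e. ?V e \<and> 0 = r y)"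
      using base digits[of y] by (subst (asm) base_mult_add_eq_iff) auto
    then show ?thesis by (cases "r y = 0") auto
  next
    case False
    then have "V b (b * m + r x) = 1" for m
      using digits[of x] by (intro V_not_dvd) (auto simp: dvd_add_right_iff dest: dvd_imp_le)
    then have "residual b r ?V e \<longleftrightarrow> b * e y + r y = b * 0 + 1" for e
      using False by (auto simp: residual_def)
    then have "residual b r ?V = (\<lambda>e. e y = 0 \<and> r y = 1)"
      using base digits[of y] by (subst (asm) base_mult_add_eq_iff) auto
    then show ?thesis by (cases "r y = 1") auto
  qed
  moreover have "residual b r ?zero = (\<lambda>e. e y = 0 \<and> r y = 0)"
    using base by (auto simp: residual_def)
  then have "residual b r ?zero \<in> ?K" by (cases "r y = 0") auto
  moreover have "residual b r (\<lambda>_. False) = (\<lambda>_. False)" by (simp add: residual_def)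
  ultimately show "residual b r Q \<in> ?K" using \<open>Q \<in> ?K\<close> by auto
qed auto

section \<open>The lexicographic criterion for admissibility\<close>

lemma funpow_shift: "(shift ^^ n) x = (\<lambda>i. x (n + i))"
  by (induction n) (auto simp: shift_def)

lemma funpow_shift_funpow_shift: "(shift ^^ m) ((shift ^^ n) x) = (shift ^^ (m + n)) x"
  by (simp add: funpow_add)

lemma cantor_real_base_pos: "cantor_real_base B \<Longrightarrow> 0 < B n"
  unfolding cantor_real_base_def by (metis less_trans zero_less_one)

lemma cantor_real_base_shift:
  assumes "cantor_real_base B"
  shows "cantor_real_base (shift B)"
proof -
  have "filterlim (\<lambda>n. \<Prod>i<Suc n. B i) at_top sequentially"
    using assms unfolding cantor_real_base_def by (subst filterlim_sequentially_Suc) simp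
  then have "filterlim (\<lambda>n. inverse (B 0) * (\<Prod>i<Suc n. B i)) at_top sequentially"
    using cantor_real_base_pos[OF assms, of 0]
    by (intro filterlim_tendsto_pos_mult_at_top[OF tendsto_const]) simp
  moreover have "inverse (B 0) * (\<Prod>i<Suc n. B i) = (\<Prod>i<n. shift B i)" for n
    using cantor_real_base_pos[OF assms, of 0]
    by (simp add: prod.lessThan_Suc_shift shift_def del: prod.lessThan_Suc)
  ultimately show ?thesis using assms by (simp add: cantor_real_base_def shift_def)
qed

lemma cantor_real_base_funpow_shift:
  "cantor_real_base B \<Longrightarrow> cantor_real_base ((shift ^^ n) B)"
  by (induction n) (auto intro: cantor_real_base_shift)

primrec left_remainder :: "(nat \<Rightarrow> real) \<Rightarrow> real \<Rightarrow> nat \<Rightarrow> real" where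
  "left_remainder B r 0 = r"
| "left_remainder B r (Suc n) =
     B n * left_remainder B r n - of_int (\<lceil>B n * left_remainder B r n\<rceil> - 1)"

lemma left_remainder_bounds:
  assumes "0 < r" "r \<le> 1"
  shows "0 < left_remainder B r n" "left_remainder B r n \<le> 1"
  using assms by (cases n; simp; linarith)+

lemma filterlim_at_left_iff:
  fixes L :: "'a::linorder_topology"
  shows "filterlim f (at_left L) F \<longleftrightarrow> (f \<longlongrightarrow> L) F \<and> (\<forall>\<^sub>F z in F. f z < L)"
  by (auto simp: filterlim_at eventually_conj_iff elim!: eventually_mono)

lemma filterlim_at_left_affine:
  fixes c d L :: real
  assumes "c > 0" "filterlim f (at_left L) F"
  shows "filterlim (\<lambda>z. c * f z - d) (at_left (c * L - d)) F"
  using assms unfolding filterlim_at_left_iff by (auto intro!: tendsto_intros)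

lemma filterlim_remainder_at_left:
  assumes "\<And>n. B n > 0"
  shows "filterlim (\<lambda>z. remainder B z n) (at_left (left_remainder B r n)) (at_left r)"
proof (induction n)
  case 0
  show ?case by (simp add: filterlim_ident)
next
  case (Suc n)
  let ?d = "\<lceil>B n * left_remainder B r n\<rceil> - 1"
  have "\<forall>\<^sub>F z in at_left r. \<lfloor>B n * remainder B z n\<rfloor> = ?d"
    using floor_at_left[OF filterlim_at_left_affine[OF assms Suc, of n 0]] by simp
  then have "\<forall>\<^sub>F z in at_left r. B n * remainder B z n - of_int ?d = remainder B z (Suc n)"
    by (rule eventually_mono) (simp add: beta_map_def)
  with filterlim_at_left_affine[OF assms Suc] show ?case
    unfolding left_remainder.simps
    by (rule filterlim_mono_eventually[OF _ order_refl order_refl])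
qed

lemma quasi_greedy_eq:
  assumes "\<And>n. B n > 0"
  shows "quasi_greedy B r n = nat (\<lceil>B n * left_remainder B r n\<rceil> - 1)"
proof -
  let ?d = "\<lceil>B n * left_remainder B r n\<rceil> - 1"
  have "\<forall>\<^sub>F z in at_left r. \<lfloor>B n * remainder B z n\<rfloor> = ?d"
    using floor_at_left[OF filterlim_at_left_affine[OF assms filterlim_remainder_at_left,
          where d = 0, OF assms]] by simp
  then have "\<forall>\<^sub>F z in at_left r. greedy B z n = nat ?d"
    by (rule eventually_mono) (simp add: greedy_def)
  then have "((\<lambda>z. greedy B z n) \<longlongrightarrow> nat ?d) (at_left r)"
    by (rule tendsto_eventually)
  moreover have "((\<lambda>z. greedy B z n) \<longlongrightarrow> quasi_greedy B r n) (at_left r)"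
    using quasi_greedy_tendsto[of B r, OF assms] by (simp add: tendsto_fun_iff[of "greedy B"])
  ultimately show ?thesis
    using tendsto_unique[OF trivial_limit_at_left_real] by blast
qed

lemma left_remainder_Suc:
  assumes "\<And>n. B n > 0" "0 < r" "r \<le> 1"
  shows "left_remainder B r (Suc n) = B n * left_remainder B r n - quasi_greedy B r n"
proof -
  have "0 < \<lceil>B n * left_remainder B r n\<rceil>"
    using assms left_remainder_bounds(1) by simp
  then show ?thesis by (simp add: quasi_greedy_eq[OF assms(1)])
qed

lemma quasi_greedy_less:
  fixes B :: "nat \<Rightarrow> real"
  assumes "\<And>n. B n > 0" "0 < r" "r \<le> 1"
  shows "quasi_greedy B r n < B n"
proof -
  have "quasi_greedy B r n < B n * left_remainder B r n"
    using left_remainder_Suc[of B r n, OF assms]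
      left_remainder_bounds(1)[OF assms(2,3), of B "Suc n"] by linarith
  also have "\<dots> \<le> B n * 1"
    using assms(1) left_remainder_bounds(2)[OF assms(2,3)]
    by (intro mult_left_mono) (auto simp: less_imp_le)
  finally show ?thesis by simp
qed

lemma remainder_bounds:
  assumes "0 \<le> x" "x < 1"
  shows "0 \<le> remainder B x n" "remainder B x n < 1"
  using assms by (cases n; simp add: beta_map_def; linarith)+

lemma remainder_add: "remainder B x (n + i) = remainder ((shift ^^ n) B) (remainder B x n) i"
  by (induction i) (auto simp: funpow_shift)

lemma funpow_shift_greedy:
  "(shift ^^ n) (greedy B x) = greedy ((shift ^^ n) B) (remainder B x n)"
  by (simp add: fun_eq_iff funpow_shift greedy_def remainder_add)

lemma remainder_Suc_greedy:
  assumes "B n > 0" "0 \<le> remainder B x n"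
  shows "remainder B x (Suc n) = B n * remainder B x n - greedy B x n"
  using assms by (simp add: beta_map_def greedy_def)

lemma left_remainder_diff_remainder:
  assumes "\<And>n. B n > 0" "0 \<le> x" "x < 1" "0 < r" "r \<le> 1"
    and "\<And>j. j < n \<Longrightarrow> greedy B x j = quasi_greedy B r j"
  shows "left_remainder B r n - remainder B x n = (\<Prod>i<n. B i) * (r - x)"
  using assms(6)
proof (induction n)
  case (Suc n)
  have "left_remainder B r (Suc n) - remainder B x (Suc n) =
      B n * (left_remainder B r n - remainder B x n)"
    using Suc.prems[of n] unfolding left_remainder_Suc[OF assms(1,4,5)]
      remainder_Suc_greedy[OF assms(1) remainder_bounds(1)[OF assms(2,3)]]
    by (simp add: algebra_simps)
  with Suc show ?case by (simp add: mult_ac del: left_remainder.simps remainder.simps)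
qed simp

text \<open>As long as the digits agree, the distance of the remainders is multiplied by the bases, so it
  cannot stay below 1 forever.\<close>

lemma less_fun_greedy_quasi_greedy:
  assumes B: "cantor_real_base B" and "0 \<le> x" "x < r" "r \<le> 1"
  shows "less_fun (greedy B x) (quasi_greedy B r)"
proof -
  let ?a = "greedy B x" and ?d = "quasi_greedy B r"
  note B_pos = cantor_real_base_pos[OF B]
  have x_bounds: "0 \<le> x" "x < 1" and r_bounds: "0 < r" "r \<le> 1"
    using assms by auto
  have distance: "left_remainder B r n - remainder B x n = (\<Prod>i<n. B i) * (r - x)"
    if "\<forall>j<n. ?a j = ?d j" for n
    using that by (intro left_remainder_diff_remainder[OF B_pos x_bounds r_bounds]) auto
  have "\<forall>\<^sub>F n in sequentially. 1 / (r - x) < (\<Prod>i<n. B i)"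
    using B by (simp add: cantor_real_base_def filterlim_at_top_dense)
  then obtain n where "1 / (r - x) < (\<Prod>i<n. B i)"
    using eventually_happens'[OF sequentially_bot] by blast
  then have "1 < (\<Prod>i<n. B i) * (r - x)"
    using \<open>x < r\<close> by (simp add: field_simps)
  then have "left_remainder B r n - remainder B x n \<noteq> (\<Prod>i<n. B i) * (r - x)"
    using left_remainder_bounds(2)[OF r_bounds, of B n] remainder_bounds(1)[OF x_bounds, of B n]
    by linarith
  then have "\<exists>k. ?a k \<noteq> ?d k" using distance by blast
  then obtain k where differ: "?a k \<noteq> ?d k" and agree: "\<forall>j<k. ?a j = ?d j"
    using exists_least_iff[of "\<lambda>k. ?a k \<noteq> ?d k"] by auto
  have "0 < (\<Prod>i<k. B i) * (r - x)"
    using B_pos \<open>x < r\<close> by (intro mult_pos_pos prod_pos) auto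
  then have "B k * remainder B x k < B k * left_remainder B r k"
    using distance[OF agree] B_pos[of k] by simp
  then have "?a k \<le> ?d k"
    unfolding greedy_def quasi_greedy_eq[of B, OF B_pos] by (intro nat_mono) linarith
  with differ agree show ?thesis unfolding less_fun_def by (intro exI[of _ k]) auto
qed

definition parry_condition :: "(nat \<Rightarrow> real) \<Rightarrow> (nat \<Rightarrow> nat) \<Rightarrow> bool" where
  "parry_condition B a \<longleftrightarrow> (\<forall>n. less_fun ((shift ^^ n) a) (quasi_greedy ((shift ^^ n) B) 1))"

lemma parry_condition_funpow_shift:
  "parry_condition B a \<Longrightarrow> parry_condition ((shift ^^ n) B) ((shift ^^ n) a)"
  unfolding parry_condition_def funpow_shift_funpow_shift by blast

lemma parry_condition_less_fun: "parry_condition B a \<Longrightarrow> less_fun a (quasi_greedy B 1)"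
  unfolding parry_condition_def by (auto dest: spec[of _ 0])

lemma parry_condition_greedy:
  assumes "cantor_real_base B" "0 \<le> x" "x < 1"
  shows "parry_condition B (greedy B x)"
  unfolding parry_condition_def funpow_shift_greedy
  by (intro allI less_fun_greedy_quasi_greedy cantor_real_base_funpow_shift
      remainder_bounds assms order_refl)

definition partial_value :: "(nat \<Rightarrow> real) \<Rightarrow> (nat \<Rightarrow> nat) \<Rightarrow> nat \<Rightarrow> real" where
  "partial_value B a m = (\<Sum>i<m. a i / (\<Prod>j\<le>i. B j))"

definition cantor_value :: "(nat \<Rightarrow> real) \<Rightarrow> (nat \<Rightarrow> nat) \<Rightarrow> real" where
  "cantor_value B a = (\<Sum>i. a i / (\<Prod>j\<le>i. B j))"

lemma partial_value_Suc:
  assumes "B 0 > 0"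
  shows "B 0 * partial_value B a (Suc m) = a 0 + partial_value (shift B) (shift a) m"
proof -
  have "(\<Prod>j\<le>Suc i. B j) = B 0 * (\<Prod>j\<le>i. shift B j)" for i
    unfolding shift_def by (rule prod.atMost_Suc_shift)
  then have "B 0 * (a (Suc i) / (\<Prod>j\<le>Suc i. B j)) = shift a i / (\<Prod>j\<le>i. shift B j)" for i
    using assms by (simp add: shift_def del: prod.atMost_Suc)
  then show ?thesis
    using assms
    by (simp add: partial_value_def sum.lessThan_Suc_shift distrib_left sum_distrib_left
        del: sum.lessThan_Suc prod.atMost_Suc)
qed

lemma less_if_less_left_remainder:
  fixes x :: "nat \<Rightarrow> real"
  assumes "\<And>n. B n > 0" "0 < r" "r \<le> 1"
    and "\<And>j. j < m \<Longrightarrow> B j * x j = quasi_greedy B r j + x (Suc j)"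
    and "x m < left_remainder B r m"
  shows "x 0 < r"
  using assms(4,5)
proof (induction m)
  case (Suc m)
  have "B m * x m < B m * left_remainder B r m"
    using Suc.prems(1)[of m] Suc.prems(2) left_remainder_Suc[of B r m, OF assms(1-3)] by simp
  then have "x m < left_remainder B r m"
    using assms(1)[of m] by (simp only: mult_less_cancel_left_pos)
  then show ?case using Suc by simp
qed simp

lemma less_if_lex_less_quasi_greedy:
  fixes x :: "nat \<Rightarrow> real"
  assumes "\<And>n. B n > 0" "0 < r" "r \<le> 1"
    and "\<And>j. j < k \<Longrightarrow> a j = quasi_greedy B r j" "a k < quasi_greedy B r k"
    and "\<And>j. j \<le> k \<Longrightarrow> B j * x j = real (a j) + x (Suc j)" "x (Suc k) \<le> 1"
  shows "x 0 < r"
proof (rule less_if_less_left_remainder[OF assms(1-3)])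
  show "B j * x j = quasi_greedy B r j + x (Suc j)" if "j < k" for j
    using assms(4)[OF that] assms(6)[of j] that by simp
  have "B k * x k \<le> quasi_greedy B r k"
    using assms(5-7) by fastforce
  also have "\<dots> < B k * left_remainder B r k"
    using left_remainder_Suc[of B r k, OF assms(1-3)]
      left_remainder_bounds(1)[OF assms(2,3), of B "Suc k"]
    by linarith
  finally show "x k < left_remainder B r k"
    using assms(1) by simp
qed

lemma partial_value_less_1:
  assumes "\<And>n. B n > 0" "parry_condition B a"
  shows "partial_value B a m < 1"
  using assms
proof (induction m arbitrary: B a rule: less_induct)
  case (less m)
  define x where "x j = partial_value ((shift ^^ j) B) ((shift ^^ j) a) (m - j)" for j
  have x_Suc: "B j * x j = a j + x (Suc j)" if "j < m" for j
    using that less.prems(1)[of j]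
      partial_value_Suc[of "(shift ^^ j) B" "(shift ^^ j) a" "m - Suc j"]
    by (simp add: x_def funpow_shift shift_def Suc_diff_Suc)
  obtain k where lex: "a k < quasi_greedy B 1 k" "\<And>j. j < k \<Longrightarrow> a j = quasi_greedy B 1 j"
    using parry_condition_less_fun[OF less.prems(2)] by (auto elim: less_funE)
  have "x 0 < 1"
  proof (cases "k < m")
    case True
    then have "x (Suc k) < 1"
      using less.prems unfolding x_def
      by (intro less.IH parry_condition_funpow_shift) (auto simp: funpow_shift shift_def)
    then show ?thesis
      using lex x_Suc True less.prems(1) by (intro less_if_lex_less_quasi_greedy[of B 1 k a x]) auto
  next
    case False
    have "x m < left_remainder B 1 m"
      by (simp add: x_def partial_value_def left_remainder_bounds(1))
    then show ?thesis
      using lex x_Suc False less.prems(1) by (intro less_if_less_left_remainder[of B 1 m x]) auto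
  qed
  then show ?case by (simp add: x_def)
qed

lemma
  assumes "\<And>n. B n > 0" "parry_condition B a"
  shows summable_cantor_value: "summable (\<lambda>i. a i / (\<Prod>j\<le>i. B j))"
    and cantor_value_nonneg: "0 \<le> cantor_value B a"
    and cantor_value_le_1: "cantor_value B a \<le> 1"
proof -
  have nonneg: "0 \<le> a i / (\<Prod>j\<le>i. B j)" for i
    using assms(1) by (intro divide_nonneg_nonneg prod_nonneg) (auto simp: less_imp_le)
  have bound: "(\<Sum>i<m. a i / (\<Prod>j\<le>i. B j)) \<le> 1" for m
    using partial_value_less_1[OF assms, of m] by (simp add: partial_value_def)
  show summable: "summable (\<lambda>i. a i / (\<Prod>j\<le>i. B j))"
    by (rule summableI_nonneg_bounded[OF nonneg bound])
  show "0 \<le> cantor_value B a"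
    unfolding cantor_value_def by (rule suminf_nonneg[OF summable nonneg])
  show "cantor_value B a \<le> 1"
    unfolding cantor_value_def by (rule suminf_le_const[OF summable bound])
qed

lemma cantor_value_shift:
  assumes "\<And>n. B n > 0" "parry_condition B a"
  shows "B 0 * cantor_value B a = a 0 + cantor_value (shift B) (shift a)"
proof (rule LIMSEQ_unique)
  have limit: "partial_value C c \<longlonglongrightarrow> cantor_value C c"
    if "\<And>n. C n > 0" "parry_condition C c" for C c
    unfolding partial_value_def cantor_value_def
    using summable_cantor_value[OF that] by (rule summable_LIMSEQ)
  show "(\<lambda>m. B 0 * partial_value B a (Suc m)) \<longlonglongrightarrow> B 0 * cantor_value B a"
    by (intro tendsto_intros LIMSEQ_Suc limit assms)
  show "(\<lambda>m. B 0 * partial_value B a (Suc m)) \<longlonglongrightarrow> a 0 + cantor_value (shift B) (shift a)"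
    unfolding partial_value_Suc[of B, OF assms(1)]
    using parry_condition_funpow_shift[OF assms(2), of 1] assms(1)
    by (intro tendsto_intros limit) (auto simp: shift_def)
qed

lemma cantor_value_funpow_shift:
  assumes "\<And>n. B n > 0" "parry_condition B a"
  shows "B n * cantor_value ((shift ^^ n) B) ((shift ^^ n) a) =
    a n + cantor_value ((shift ^^ Suc n) B) ((shift ^^ Suc n) a)"
proof -
  have "0 < (shift ^^ n) B i" for i
    using assms(1) by (simp add: funpow_shift)
  from cantor_value_shift[OF this parry_condition_funpow_shift[OF assms(2)]]
  show ?thesis by (simp add: funpow_shift)
qed

lemma cantor_value_less_1:
  assumes "\<And>n. B n > 0" "parry_condition B a"
  shows "cantor_value B a < 1"
proof -
  define x where "x j = cantor_value ((shift ^^ j) B) ((shift ^^ j) a)" for j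
  obtain k where lex: "a k < quasi_greedy B 1 k" "\<And>j. j < k \<Longrightarrow> a j = quasi_greedy B 1 j"
    using parry_condition_less_fun[OF assms(2)] by (auto elim: less_funE)
  have "x (Suc k) \<le> 1"
    using assms unfolding x_def
    by (intro cantor_value_le_1 parry_condition_funpow_shift) (auto simp: funpow_shift shift_def)
  then have "x 0 < 1"
    using lex assms(1) cantor_value_funpow_shift[OF assms]
    by (intro less_if_lex_less_quasi_greedy[of B 1 k a x]) (auto simp: x_def)
  then show ?thesis by (simp add: x_def)
qed

lemma greedy_cantor_value:
  assumes "\<And>n. B n > 0" "parry_condition B a"
  shows "greedy B (cantor_value B a) = a"
proof -
  define x where "x n = cantor_value ((shift ^^ n) B) ((shift ^^ n) a)" for n
  have "0 < (shift ^^ n) B i" for n i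
    using assms(1) by (simp add: funpow_shift)
  then have x_bounds: "0 \<le> x n" "x n < 1" for n
    using parry_condition_funpow_shift[OF assms(2)]
    by (simp_all add: x_def cantor_value_nonneg cantor_value_less_1)
  have x_Suc: "B n * x n = a n + x (Suc n)" for n
    unfolding x_def by (rule cantor_value_funpow_shift[OF assms])
  then have floor_x: "\<lfloor>B n * x n\<rfloor> = int (a n)" for n
    using x_bounds[of "Suc n"] by (simp add: floor_eq_iff)
  have "remainder B (x 0) n = x n" for n
    by (induction n) (simp_all add: beta_map_def floor_x, simp add: x_Suc)
  then show ?thesis
    by (simp add: fun_eq_iff greedy_def floor_x flip: x_def[of 0, simplified])
qed

lemma admissible_iff_parry_condition:
  assumes "cantor_real_base B"
  shows "admissible B a \<longleftrightarrow> parry_condition B a"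
proof
  show "parry_condition B a" if "admissible B a"
    using that parry_condition_greedy[OF assms] by (auto simp: admissible_def)
  note B_pos = cantor_real_base_pos[OF assms]
  show "admissible B a" if "parry_condition B a"
    unfolding admissible_def
    using cantor_value_nonneg[of B a, OF B_pos that] cantor_value_less_1[of B a, OF B_pos that]
      greedy_cantor_value[of B a, OF B_pos that] by metis
qed

section \<open>Uniformly automatic families of predicates\<close>

definition recursive_family :: "(nat \<Rightarrow> (nat \<Rightarrow> nat) \<Rightarrow> bool) \<Rightarrow> bool" where
  "recursive_family F \<longleftrightarrow> (\<forall>p. recursive_pred (Suc p) (\<lambda>xs. F (hd xs) (nth_default 0 (tl xs))))"

text \<open>The computable bound on the kernels is what makes the search for witnesses of quantifiers
  finite. The parameter \<open>c\<close> will be the code of an automaton.\<close>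

definition uniformly_automatic :: "nat \<Rightarrow> (nat \<Rightarrow> (nat \<Rightarrow> nat) \<Rightarrow> bool) \<Rightarrow> bool" where
  "uniformly_automatic b F \<longleftrightarrow> recursive_family F \<and>
     (\<exists>h. recursive 1 (\<lambda>xs. h (hd xs)) \<and> (\<forall>c. kernel_bounded b (h c) (F c)))"

lemma uniformly_automaticI:
  assumes "recursive 1 (\<lambda>xs. h (hd xs))" "\<And>c. kernel_bounded b (h c) (F c)"
    and "\<And>p. recursive_pred (Suc p) (\<lambda>xs. F (hd xs) (nth_default 0 (tl xs)))"
  shows "uniformly_automatic b F"
  using assms unfolding uniformly_automatic_def recursive_family_def by blast

lemma uniformly_automaticE:
  assumes "uniformly_automatic b F"
  obtains h where "recursive 1 (\<lambda>xs. h (hd xs))" "\<And>c. kernel_bounded b (h c) (F c)"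
    "\<And>p. recursive_pred (Suc p) (\<lambda>xs. F (hd xs) (nth_default 0 (tl xs)))"
  using assms unfolding uniformly_automatic_def recursive_family_def by blast

lemma uniformly_automatic_not:
  assumes "uniformly_automatic b F"
  shows "uniformly_automatic b (\<lambda>c e. \<not> F c e)"
  using assms by (elim uniformly_automaticE)
    (rule uniformly_automaticI, auto intro: kernel_bounded_not recursive_pred_not)

lemma uniformly_automatic_conj:
  assumes "uniformly_automatic b F" "uniformly_automatic b G"
  shows "uniformly_automatic b (\<lambda>c e. F c e \<and> G c e)"
proof -
  obtain h where F: "recursive 1 (\<lambda>xs. h (hd xs))" "\<And>c. kernel_bounded b (h c) (F c)"
    "\<And>p. recursive_pred (Suc p) (\<lambda>xs. F (hd xs) (nth_default 0 (tl xs)))"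
    using assms(1) by (rule uniformly_automaticE) blast
  obtain h' where G: "recursive 1 (\<lambda>xs. h' (hd xs))" "\<And>c. kernel_bounded b (h' c) (G c)"
    "\<And>p. recursive_pred (Suc p) (\<lambda>xs. G (hd xs) (nth_default 0 (tl xs)))"
    using assms(2) by (rule uniformly_automaticE) blast
  show ?thesis
    by (rule uniformly_automaticI[of "\<lambda>c. h c * h' c"])
      (intro recursive_mult kernel_bounded_conj recursive_pred_conj F G)+
qed

lemma uniformly_automatic_disj:
  assumes "uniformly_automatic b F" "uniformly_automatic b G"
  shows "uniformly_automatic b (\<lambda>c e. F c e \<or> G c e)"
  using uniformly_automatic_not[OF uniformly_automatic_conj[OF assms[THEN uniformly_automatic_not]]]
  by simp

lemma uniformly_automatic_imp:
  assumes "uniformly_automatic b F" "uniformly_automatic b G"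
  shows "uniformly_automatic b (\<lambda>c e. F c e \<longrightarrow> G c e)"
  using uniformly_automatic_disj[OF uniformly_automatic_not[OF assms(1)] assms(2)]
  by simp

lemma uniformly_automatic_False: "uniformly_automatic b (\<lambda>_ _. False)"
  by (rule uniformly_automaticI[of "\<lambda>_. 1"])
    (rule recursive_const kernel_bounded_False recursive_pred_False)+

lemma uniformly_automatic_Bex:
  assumes "finite I" "\<And>i. i \<in> I \<Longrightarrow> uniformly_automatic b (F i)"
  shows "uniformly_automatic b (\<lambda>c e. \<exists>i\<in>I. F i c e)"
  using assms
  by (induction I rule: finite_induct)
    (simp_all add: uniformly_automatic_False uniformly_automatic_disj)

lemma uniformly_automatic_rel_if_fibres:
  assumes "finite A" "\<And>a. a \<in> A \<Longrightarrow> finite {v. R v a}" "\<And>c e. g c e \<in> A"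
    and "\<And>v. uniformly_automatic b (\<lambda>c e. f c e = v)"
    and "\<And>a. a \<in> A \<Longrightarrow> uniformly_automatic b (\<lambda>c e. g c e = a)"
  shows "uniformly_automatic b (\<lambda>c e. R (f c e) (g c e))"
proof -
  have "uniformly_automatic b (\<lambda>c e. \<exists>a\<in>A. (\<exists>v\<in>{v. R v a}. f c e = v) \<and> g c e = a)"
    using assms by (intro uniformly_automatic_Bex uniformly_automatic_conj)
  moreover have "(\<exists>a\<in>A. (\<exists>v\<in>{v. R v a}. f c e = v) \<and> g c e = a) \<longleftrightarrow> R (f c e) (g c e)" for c e
    using assms(3) by auto
  ultimately show ?thesis by simp
qed

lemma Ex_iff_bounded_if_kernel_bounded:
  assumes "b \<ge> 2" "kernel_bounded b N P"
  shows "(\<exists>k. P ((nth_default 0 xs)(x := k))) \<longleftrightarrow>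
    (\<exists>k<b ^ (sum_list xs + N). P ((nth_default 0 xs)(x := k)))"
proof -
  have "nth_default 0 xs i < b ^ sum_list xs" for i
  proof -
    have "nth_default 0 xs i \<le> sum_list xs"
      by (simp add: nth_default_def elem_le_sum_list)
    also have "\<dots> < b ^ sum_list xs"
      using assms(1) by (intro power_gt_expt) auto
    finally show ?thesis .
  qed
  then show ?thesis
    using bounded_witness_if_kernel_bounded[OF assms] by blast
qed

lemma recursive_pred_fun_upd:
  assumes "recursive_family F"
  shows "recursive_pred (Suc (Suc p))
    (\<lambda>ys. F (hd (tl ys)) ((nth_default 0 (tl (tl ys)))(x := hd ys)))"
proof -
  obtain m where m: "p \<le> m" "x < m"
    by (rule that[of "max p (Suc x)"]) auto
  let ?e = "\<lambda>ys. (nth_default 0 (tl (tl ys)))(x := hd ys)"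
  have "recursive_pred (Suc (Suc p)) (\<lambda>ys. F (hd (tl ys)) (nth_default 0 (map (?e ys) [0..<m])))"
  proof -
    have "recursive (Suc m) (\<lambda>xs. of_bool (F (hd xs) (nth_default 0 (tl xs))))"
      using assms by (simp add: recursive_family_def recursive_pred_def)
    moreover have "recursive (Suc (Suc p)) (\<lambda>ys. map (?e ys) [0..<m] ! i)" if "i < m" for i
      using that by (cases "i = x") (auto intro!: recursive_intros)
    ultimately show ?thesis
      using recursive_subst_Cons[where f = "\<lambda>xs. of_bool (F (hd xs) (nth_default 0 (tl xs)))"
          and n = "\<lambda>ys. hd (tl ys)" and s = "\<lambda>ys. map (?e ys) [0..<m]"]
      by (simp add: recursive_pred_def recursive_intros)
  qed
  then show ?thesis
  proof (rule recursive_pred_cong)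
    fix ys :: "nat list"
    assume "length ys = Suc (Suc p)"
    then have "nth_default 0 (map (?e ys) [0..<m]) = ?e ys"
      using m by (auto simp: fun_eq_iff nth_default_def)
    then show "F (hd (tl ys)) (?e ys) = F (hd (tl ys)) (nth_default 0 (map (?e ys) [0..<m]))"
      by (rule arg_cong[OF sym])
  qed
qed

lemma uniformly_automatic_Ex:
  assumes base: "b \<ge> 2" and F: "uniformly_automatic b F"
  shows "uniformly_automatic b (\<lambda>c e. \<exists>k. F c (e(x := k)))"
proof -
  obtain h where recursive_h: "recursive 1 (\<lambda>xs. h (hd xs))"
    and bounded: "\<And>c. kernel_bounded b (h c) (F c)"
    using F by (rule uniformly_automaticE) blast
  show ?thesis
  proof (rule uniformly_automaticI)
    show "recursive 1 (\<lambda>xs. 2 ^ h (hd xs))"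
      by (intro recursive_intros recursive_h)
    show "kernel_bounded b (2 ^ h c) (\<lambda>e. \<exists>k. F c (e(x := k)))" for c
      using base by (intro kernel_bounded_Ex bounded) auto
    have "recursive_family F"
      using F by (simp add: uniformly_automatic_def)
    then show "recursive_pred (Suc p) (\<lambda>xs. \<exists>k. F (hd xs) ((nth_default 0 (tl xs))(x := k)))" for p
      unfolding Ex_iff_bounded_if_kernel_bounded[OF base bounded]
      by (intro recursive_pred_bex recursive_pred_fun_upd recursive_power recursive_add
          recursive_tl[OF recursive_sum_list] recursive_unary[OF recursive_h] recursive_hd
          recursive_const)
  qed
qed

lemma uniformly_automatic_All:
  assumes "b \<ge> 2" "uniformly_automatic b F"
  shows "uniformly_automatic b (\<lambda>c e. \<forall>k. F c (e(x := k)))"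
  using uniformly_automatic_not[OF uniformly_automatic_Ex[OF assms(1)
        uniformly_automatic_not[OF assms(2)]]] by simp

lemma uniformly_automatic_subst:
  assumes "b \<ge> 2" "uniformly_automatic b F" "uniformly_automatic b (\<lambda>_ e. t e = e x)"
    and "\<And>e k. t (e(x := k)) = t e"
  shows "uniformly_automatic b (\<lambda>c e. F c (e(x := t e)))"
  using uniformly_automatic_Ex[OF assms(1) uniformly_automatic_conj[OF assms(2,3)], of x]
  by (simp add: assms(4))

lemma uniformly_automatic_eq: "uniformly_automatic b (\<lambda>_ e. e x = e y)"
  by (rule uniformly_automaticI[of "\<lambda>_. 2"]) (intro recursive_intros kernel_bounded_eq)+

lemma uniformly_automatic_eq_const: "uniformly_automatic b (\<lambda>_ e. e x = n)"
  by (rule uniformly_automaticI[of "\<lambda>_. n + 2"]) (intro recursive_intros kernel_bounded_eq_const)+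

lemma uniformly_automatic_add: "uniformly_automatic b (\<lambda>_ e. e x + e y = e z)"
  by (rule uniformly_automaticI[of "\<lambda>_. 3"]) (intro recursive_intros kernel_bounded_add)+

lemma uniformly_automatic_less:
  assumes "b \<ge> 2"
  shows "uniformly_automatic b (\<lambda>_ e. e x < e y)"
proof -
  define z where "z = Suc (x + y)"
  have "uniformly_automatic b
      (\<lambda>_ e. (\<exists>k. (e(z := k)) x + (e(z := k)) z = (e(z := k)) y) \<and> e x \<noteq> e y)"
    by (intro uniformly_automatic_conj uniformly_automatic_not uniformly_automatic_eq
        uniformly_automatic_Ex[of b "\<lambda>_ e. e x + e z = e y"] uniformly_automatic_add assms)
  moreover have "(\<exists>k. (e(z := k)) x + (e(z := k)) z = (e(z := k)) y) \<and> e x \<noteq> e y \<longleftrightarrow> e x < e y"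
    for e :: "nat \<Rightarrow> nat"
    by (simp add: z_def) (metis le_iff_add less_le)
  ultimately show ?thesis by simp
qed

lemma V_eq_power_Least:
  assumes "b \<ge> 2"
  shows "V b n = b ^ (LEAST k. n = 0 \<or> n mod b ^ Suc k \<noteq> 0)"
proof (cases "n = 0")
  case False
  have "(LEAST k. n = 0 \<or> n mod b ^ Suc k \<noteq> 0) = multiplicity b n"
    using False assms power_dvd_iff_le_multiplicity[of n b]
    by (intro Least_equality) (auto simp: mod_eq_0_iff_dvd Suc_le_eq simp del: power_Suc)
  with False show ?thesis by (simp add: V_def)
qed (simp add: V_0)

lemma recursive_V:
  assumes "b \<ge> 2" "recursive k f"
  shows "recursive k (\<lambda>xs. V b (f xs))"
proof -
  have "recursive k (\<lambda>xs. LEAST i. f xs = 0 \<or> f xs mod b ^ Suc i \<noteq> 0)"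
  proof (rule recursive_Least)
    show "recursive_pred (Suc k) (\<lambda>ys. f (tl ys) = 0 \<or> f (tl ys) mod b ^ Suc (hd ys) \<noteq> 0)"
      by (intro recursive_intros assms(2))
    have "n < b ^ Suc n" for n
      using assms(1) power_gt_expt[of b "Suc n"] by simp
    then show "\<exists>i. f xs = 0 \<or> f xs mod b ^ Suc i \<noteq> 0" for xs
      by (metis mod_less)
  qed
  then show ?thesis
    unfolding V_eq_power_Least[OF assms(1)] by (intro recursive_intros)
qed

lemma uniformly_automatic_V:
  assumes "b \<ge> 2"
  shows "uniformly_automatic b (\<lambda>_ e. V b (e x) = e y)"
proof -
  have "uniformly_automatic b (\<lambda>_ e. 0 < e x \<and> V b (e x) = e y)"
    by (rule uniformly_automaticI[of "\<lambda>_. 3"])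
      (intro recursive_intros recursive_V kernel_bounded_V_pos assms)+
  then have "uniformly_automatic b
      (\<lambda>_ e. 0 < e x \<and> V b (e x) = e y \<or> e x = 0 \<and> e y = 1)"
    by (rule uniformly_automatic_disj)
      (intro uniformly_automatic_conj uniformly_automatic_eq_const)
  moreover have "0 < e x \<and> V b (e x) = e y \<or> e x = 0 \<and> e y = 1 \<longleftrightarrow> V b (e x) = e y" for e
    by (cases "e x = 0") (auto simp: V_0)
  ultimately show ?thesis by simp
qed

lemma uniformly_automatic_fo_sat:
  assumes "b \<ge> 2"
  shows "uniformly_automatic b (\<lambda>_ e. fo_sat b e f)"
proof (induction f)
  case (Ex x f)
  then show ?case using uniformly_automatic_Ex[OF assms, of "\<lambda>_ e. fo_sat b e f"] by simp
qed (simp_all add: assms uniformly_automatic_eq uniformly_automatic_add uniformly_automatic_V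
    uniformly_automatic_not uniformly_automatic_conj)

lemma uniformly_automatic_less_fun:
  assumes base: "b \<ge> 2"
    and eq: "uniformly_automatic b (\<lambda>c e. f c (e 1) (e 0) = g c (e 1) (e 0))"
    and less: "uniformly_automatic b (\<lambda>c e. f c (e 1) (e 0) < g c (e 1) (e 0))"
  shows "uniformly_automatic b (\<lambda>c e. less_fun (f c (e 1)) (g c (e 1)))"
proof -
  have "uniformly_automatic b (\<lambda>c e. \<forall>j<e 2. f c (e 1) j = g c (e 1) j)"
    using uniformly_automatic_All[OF base uniformly_automatic_imp[OF
          uniformly_automatic_less[OF base, of 0 2] eq], of 0] by simp
  from uniformly_automatic_subst[OF base this uniformly_automatic_eq[of b 0 2]]
  have "uniformly_automatic b (\<lambda>c e. \<forall>j<e 0. f c (e 1) j = g c (e 1) j)"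
    by simp
  from uniformly_automatic_Ex[OF base uniformly_automatic_conj[OF less this], of 0]
  show ?thesis by (simp add: less_fun_def)
qed

section \<open>Automata given by their codes\<close>

definition dfao_decode :: "nat \<Rightarrow> dfao" where
  "dfao_decode c =
     DFAO (fst (prod_decode c))
       (map list_decode (list_decode (fst (prod_decode (snd (prod_decode c))))))
       (list_decode (snd (prod_decode (snd (prod_decode c)))))"

lemma dfao_decode_inverse [simp]: "dfao_encode (dfao_decode c) = c"
  by (simp add: dfao_encode_def dfao_decode_def comp_def)

lemma dfao_encode_inverse [simp]: "dfao_decode (dfao_encode M) = M"
  by (cases M) (simp add: dfao_encode_def dfao_decode_def comp_def)

text \<open>With missing table entries read as 0, every code yields a sequence, and this sequence depends
  recursively on the code.\<close>

definition default_step :: "dfao \<Rightarrow> nat \<Rightarrow> nat \<Rightarrow> nat" where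
  "default_step M q r = nth_default 0 (nth_default [] (trans M) q) r"

definition default_run :: "nat \<Rightarrow> dfao \<Rightarrow> nat \<Rightarrow> nat" where
  "default_run b M n = foldl (default_step M) (init M) (base_rep b n)"

definition default_seq :: "nat \<Rightarrow> dfao \<Rightarrow> nat \<Rightarrow> nat" where
  "default_seq b M n = nth_default 0 (outp M) (default_run b M n)"

lemma wf_dfao_iff:
  "wf_dfao b M \<longleftrightarrow>
     init M < length (outp M) \<and> length (trans M) = length (outp M) \<and>
     (\<forall>q<length (trans M). length (nth_default [] (trans M) q) = b \<and>
        (\<forall>r<b. default_step M q r < length (outp M)))"
  unfolding wf_dfao_def all_set_conv_all_nth by (auto simp: default_step_def nth_default_nth)

lemma base_rep_less: "b \<ge> 2 \<Longrightarrow> r \<in> set (base_rep b n) \<Longrightarrow> r < b"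
proof (induction b n rule: base_rep.induct)
  case (1 b n)
  then show ?case
    by (subst (asm) (2) base_rep.simps) (auto split: if_splits)
qed

lemma default_seq_eq_dfao_seq:
  assumes "wf_dfao b M" "b \<ge> 2"
  shows "default_seq b M = dfao_seq b M"
proof
  fix n
  let ?step = "\<lambda>q r. trans M ! q ! r"
  have step: "default_step M q r = ?step q r" "?step q r < length (outp M)"
    if "q < length (outp M)" "r < b" for q r
    using that assms(1) unfolding wf_dfao_iff by (auto simp: default_step_def nth_default_nth)
  have "foldl (default_step M) q w = foldl ?step q w \<and> foldl ?step q w < length (outp M)"
    if "q < length (outp M)" "\<forall>r\<in>set w. r < b" for q w
    using that by (induction w arbitrary: q) (auto simp: step)
  from this[of "init M" "base_rep b n"] show "default_seq b M n = dfao_seq b M n"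
    using assms base_rep_less
    by (auto simp: wf_dfao_def default_seq_def default_run_def dfao_seq_def dfao_run_def
        nth_default_nth)
qed

lemma default_run_0: "default_run b M 0 = init M"
  by (simp add: default_run_def base_rep.simps)

lemma default_run_pos:
  assumes "b \<ge> 2" "n > 0"
  shows "default_run b M n = default_step M (default_run b M (n div b)) (n mod b)"
  using assms by (simp add: default_run_def base_rep.simps[of b n])

lemma nth_default_le_list_encode: "nth_default 0 xs i \<le> list_encode xs"
proof (induction xs arbitrary: i)
  case (Cons x xs)
  then show ?case
    using le_prod_encode_1[of x "list_encode xs"] le_prod_encode_2[of "list_encode xs" x]
    by (cases i) (auto intro: le_SucI order_trans)
qed simp

lemma default_step_le: "default_step M q r \<le> dfao_encode M"
proof -
  have "default_step M q r \<le> list_encode (nth_default [] (trans M) q)"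
    unfolding default_step_def by (rule nth_default_le_list_encode)
  also have "\<dots> = nth_default 0 (map list_encode (trans M)) q"
    by (simp add: nth_default_map_eq[where dflt' = "[]"])
  also have "\<dots> \<le> list_encode (map list_encode (trans M))"
    by (rule nth_default_le_list_encode)
  also have "\<dots> \<le> dfao_encode M"
    unfolding dfao_encode_def by (rule order_trans[OF le_prod_encode_1 le_prod_encode_2])
  finally show ?thesis .
qed

lemma default_run_le:
  assumes "b \<ge> 2"
  shows "default_run b M n \<le> dfao_encode M"
proof (cases "n = 0")
  case True
  then show ?thesis by (simp add: default_run_0 dfao_encode_def le_prod_encode_1)
qed (simp add: assms default_run_pos default_step_le)

text \<open>The residuals of the fibres of the sequence are given by the sets of states from which an
  accepting output is reached after appending fixed digits; zero is represented by the empty word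
  and has to be treated separately.\<close>

lemma kernel_bounded_default_seq:
  assumes base: "b \<ge> 2"
  shows "kernel_bounded b (2 * 2 ^ Suc (dfao_encode M)) (\<lambda>e. default_seq b M (e x) = v)"
proof (rule kernel_bounded_image)
  let ?states = "{..dfao_encode M}"
  let ?S = "(UNIV :: bool set) \<times> Pow ?states"
  let ?accept = "\<lambda>(t, Q) e. if e x = 0 then t else default_run b M (e x) \<in> Q"
  show "finite ?S" "card ?S \<le> 2 * 2 ^ Suc (dfao_encode M)"
    by (auto simp: card_cartesian_product card_Pow)
  show "(\<lambda>e. default_seq b M (e x) = v) \<in> ?accept ` ?S"
    by (rule rev_image_eqI[of "(nth_default 0 (outp M) (init M) = v,
          {q \<in> ?states. nth_default 0 (outp M) q = v})"])
      (auto simp: default_seq_def default_run_0 default_run_le[OF base])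
  fix s and r :: "'a \<Rightarrow> nat"
  assume "s \<in> ?S" and digits: "\<And>i. r i < b"
  obtain t Q where s_eq: "s = (t, Q)" by (cases s)
  let ?t = "if r x = 0 then t else default_step M (init M) (r x) \<in> Q"
  let ?Q = "{q \<in> ?states. default_step M q (r x) \<in> Q}"
  have "default_run b M (b * n + r x) = default_step M (default_run b M n) (r x)"
    if "0 < b * n + r x" for n
    using that base digits[of x] by (subst default_run_pos) auto
  then have "residual b r (?accept s) = ?accept (?t, ?Q)"
    using base by (auto simp: fun_eq_iff residual_def s_eq default_run_0 default_run_le)
  then show "residual b r (?accept s) \<in> ?accept ` ?S"
    by (rule image_eqI) auto
qed

lemma dfao_decode_sel:
  "init (dfao_decode c) = fst (prod_decode c)"
  "length (trans (dfao_decode c)) =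
    length (list_decode (fst (prod_decode (snd (prod_decode c)))))"
  "nth_default [] (trans (dfao_decode c)) q =
    list_decode (nth_default 0 (list_decode (fst (prod_decode (snd (prod_decode c))))) q)"
  "outp (dfao_decode c) = list_decode (snd (prod_decode (snd (prod_decode c))))"
  by (simp_all add: dfao_decode_def nth_default_map_eq[where dflt' = 0])

lemma recursive_default_step [recursive_intros]:
  assumes "recursive k f" "recursive k g" "recursive k h"
  shows "recursive k (\<lambda>xs. default_step (dfao_decode (f xs)) (g xs) (h xs))"
  unfolding default_step_def dfao_decode_sel by (intro recursive_intros assms)

lemma recursive_pred_wf_dfao [recursive_intros]:
  assumes "recursive k f"
  shows "recursive_pred k (\<lambda>xs. wf_dfao b (dfao_decode (f xs)))"
  unfolding wf_dfao_iff dfao_decode_sel by (intro recursive_intros assms)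

lemma default_run_div_power:
  assumes "b \<ge> 2" "i \<le> n"
  shows "default_run b M (n div b ^ (n - i)) =
    rec_nat (init M) (\<lambda>i q. if n div b ^ (n - Suc i) = 0 then init M
      else default_step M q (n div b ^ (n - Suc i) mod b)) i"
  using assms(2)
proof (induction i)
  case 0
  have "n < b ^ n" using assms(1) by (intro power_gt_expt) auto
  then show ?case by (simp add: default_run_0)
next
  case (Suc i)
  have "n - i = Suc (n - Suc i)" using Suc.prems by simp
  then have "n div b ^ (n - Suc i) div b = n div b ^ (n - i)"
    by (simp add: div_mult2_eq[symmetric] mult.commute)
  then show ?case
    using Suc assms(1) default_run_pos[of b "n div b ^ (n - Suc i)" M] by (auto simp: default_run_0)
qed

lemma recursive_default_seq:
  assumes "b \<ge> 2" "recursive k f" "recursive k g"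
  shows "recursive k (\<lambda>xs. default_seq b (dfao_decode (f xs)) (g xs))"
proof -
  have "recursive k (\<lambda>xs. default_run b (dfao_decode (f xs)) (g xs div b ^ (g xs - g xs)))"
    unfolding default_run_div_power[OF assms(1) order_refl] dfao_decode_sel
    by (intro recursive_rec_nat recursive_intros assms)
  then show ?thesis
    unfolding default_seq_def dfao_decode_sel by (intro recursive_intros assms) simp
qed

lemma uniformly_automatic_default_seq:
  assumes "b \<ge> 2"
  shows "uniformly_automatic b (\<lambda>c e. default_seq b (dfao_decode c) (e x) = v)"
proof (rule uniformly_automaticI)
  show "kernel_bounded b (2 * 2 ^ Suc c) (\<lambda>e. default_seq b (dfao_decode c) (e x) = v)" for c
    using kernel_bounded_default_seq[OF assms, of "dfao_decode c"] by simp
  show "recursive 1 (\<lambda>xs. 2 * 2 ^ Suc (hd xs))"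
    unfolding One_nat_def by (intro recursive_intros)
qed (intro recursive_intros recursive_default_seq assms)

lemma decidable_dfao_seq_if_uniformly_automatic:
  assumes base: "b \<ge> 2" and P: "uniformly_automatic b (\<lambda>c _. P (default_seq b (dfao_decode c)))"
  shows "decidable {dfao_encode M | M. wf_dfao b M \<and> P (dfao_seq b M)}"
proof -
  have "recursive_pred 1 (\<lambda>xs. P (default_seq b (dfao_decode (hd xs))))"
    using P by (simp add: uniformly_automatic_def recursive_family_def One_nat_def)
  then have "recursive_pred 1 (\<lambda>xs. wf_dfao b (dfao_decode (hd xs)) \<and>
      P (default_seq b (dfao_decode (hd xs))))"
    unfolding One_nat_def by (intro recursive_intros)
  moreover have "wf_dfao b (dfao_decode c) \<and> P (default_seq b (dfao_decode c)) \<longleftrightarrow>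
      c \<in> {dfao_encode M | M. wf_dfao b M \<and> P (dfao_seq b M)}" (is "_ \<longleftrightarrow> c \<in> ?D") for c
    using default_seq_eq_dfao_seq[OF _ base] by (auto intro!: exI[of _ "dfao_decode c"])
  ultimately have "recursive_pred 1 (\<lambda>xs. hd xs \<in> ?D)" by simp
  then have "recursive_pred 1 (\<lambda>xs. xs ! 0 \<in> ?D)"
    by (rule recursive_pred_cong) (auto simp: length_Suc_conv)
  then show ?thesis by (simp add: decidable_def recursive_pred_def of_bool_def)
qed

section \<open>Decidability of admissibility\<close>

lemma finite_quasi_greedy_digits:
  fixes B :: "nat \<Rightarrow> real"
  assumes "\<And>n. B n > 0" "bdd_above (range B)"
  shows "finite {quasi_greedy ((shift ^^ n) B) 1 j | n j. True}"
proof -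
  obtain u where upper_bound: "B n \<le> u" for n
    using assms(2) by (auto simp: bdd_above_def)
  have "quasi_greedy ((shift ^^ n) B) 1 j \<le> nat \<lceil>u\<rceil>" for n j
  proof -
    have "real (quasi_greedy ((shift ^^ n) B) 1 j) < (shift ^^ n) B j"
      using assms(1) by (intro quasi_greedy_less) (auto simp: funpow_shift)
    also have "\<dots> \<le> u" using upper_bound by (simp add: funpow_shift)
    finally show ?thesis by linarith
  qed
  then have "{quasi_greedy ((shift ^^ n) B) 1 j | n j. True} \<subseteq> {..nat \<lceil>u\<rceil>}" by auto
  then show ?thesis by (rule finite_subset) simp
qed

lemma uniformly_automatic_less_fun_shift:
  assumes base: "b \<ge> 2" and "finite A" "\<And>n j. d n j \<in> A"
    and fibre: "\<And>a. a \<in> A \<Longrightarrow> uniformly_automatic b (\<lambda>_ e. d (e 1) (e 0) = a)"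
  shows "uniformly_automatic b
    (\<lambda>c e. less_fun ((shift ^^ e 1) (default_seq b (dfao_decode c))) (d (e 1)))"
proof -
  let ?s = "\<lambda>c. default_seq b (dfao_decode c)"
  have "uniformly_automatic b (\<lambda>c e. ?s c (e 1 + e 0) = v)" for v
    using uniformly_automatic_subst[OF base uniformly_automatic_default_seq[OF base, of 2]
        uniformly_automatic_add[of b 1 0 2]] by simp
  then have compare: "uniformly_automatic b (\<lambda>c e. R (?s c (e 1 + e 0)) (d (e 1) (e 0)))"
    if "\<And>a. finite {v. R v a}" for R
    by (rule uniformly_automatic_rel_if_fibres[where R = R and f = "\<lambda>c e. ?s c (e 1 + e 0)"
          and g = "\<lambda>_ e. d (e 1) (e 0)", OF \<open>finite A\<close> that assms(3) _ fibre])
  show ?thesis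
    using uniformly_automatic_less_fun[OF base, of "\<lambda>c n i. ?s c (n + i)" "\<lambda>_. d"]
      compare[of "(=)"] compare[of "(<)"]
    by (simp add: funpow_shift)
qed

theorem theorem6p3:
  fixes E :: "real set" and B :: "nat \<Rightarrow> real" and b :: nat
    and A :: "nat set" and \<phi> :: "nat \<Rightarrow> fo_formula"
  assumes "finite E" and "E \<subseteq> {1<..}"
    and "\<forall>n. B n \<in> E" and "cantor_real_base B"
    and "b \<ge> 2"
    and "A = {quasi_greedy ((shift ^^ n) B) 1 j | n j. True}"
    and "\<forall>a \<in> A. free_vars (\<phi> a) \<subseteq> {0, 1} \<and>
           (\<forall>e j n. fo_sat b (e(0 := j, 1 := n)) (\<phi> a) \<longleftrightarrow>
                    quasi_greedy ((shift ^^ n) B) 1 j = a)"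
  shows "decidable {dfao_encode M | M. wf_dfao b M \<and> admissible B (dfao_seq b M)}"
proof -
  let ?d = "\<lambda>n. quasi_greedy ((shift ^^ n) B) 1" and ?s = "\<lambda>c. default_seq b (dfao_decode c)"
  have "bdd_above (range B)"
    using assms(1,3) by (auto intro: bdd_above_mono[OF bdd_above_finite])
  then have "finite A"
    using finite_quasi_greedy_digits cantor_real_base_pos[OF assms(4)] assms(6) by blast
  moreover have "uniformly_automatic b (\<lambda>_ e. ?d (e 1) (e 0) = a)" if "a \<in> A" for a
  proof -
    have "fo_sat b (e(0 := e 0, 1 := e 1)) (\<phi> a) \<longleftrightarrow> ?d (e 1) (e 0) = a" for e
      using assms(7) that by (simp only:)
    with uniformly_automatic_fo_sat[OF assms(5), of "\<phi> a"] show ?thesis by simp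
  qed
  ultimately have "uniformly_automatic b (\<lambda>c e. less_fun ((shift ^^ e 1) (?s c)) (?d (e 1)))"
    by (intro uniformly_automatic_less_fun_shift[OF assms(5)]) (auto simp: assms(6))
  from uniformly_automatic_All[OF assms(5) this, of 1]
  have "uniformly_automatic b (\<lambda>c _. admissible B (?s c))"
    by (simp add: admissible_iff_parry_condition[OF assms(4)] parry_condition_def)
  then show ?thesis by (rule decidable_dfao_seq_if_uniformly_automatic[OF assms(5)])
qed

end
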